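(* The problem Min-ICR-Exact is solvable in polynomial time when restricted to inputs $(I,\succ_{M,W},\mu)$ in which $I$ is an instance of SMTI whose indifference classes all have size at most $2$.
   Context: SMPI. An instance $I=(M,W,p_{M,W})$ of SMPI (Stable Marriage with Partially ordered preferences and Incomplete lists) consists of $n$ men $M$, $n$ women $W$, a set of mutually acceptable (man, woman) pairs, and for each agent $a\in M\cup W$ a strict partial order $p_a$ on the set of $a$'s acceptable candidates (agents of the opposite side). $(c_1,c_2)\in p_a$ means $a$ strictly prefers $c_1$ to $c_2$; $a$ cannot compare distinct $c_1,c_2$ if neither $(c_1,c_2)$ nor $(c_2,c_1)$ is in $p_a$. Every agent strictly prefers each acceptable candidate to being unmatched. SMTI is the special case in which each agent's incomparability relation is transitive: each agent's acceptable candidates are partitioned into indifference classes (ties), strictly ordered among themselves, and two candidates are incomparable exactly when they are in the same class. Refinement. An instance $I'$ (same agents and acceptable pairs, with relations $p'_a$) refines $I$ if for each agent $a$ every strict total order that is a linear extension of $p'_a$ is a linear extension of $p_a$. A strict preference profile $\succ_{M,W}=(\succ_a)_{a\in M\cup W}$ (each $\succ_a$ a strict total order on $a$'s acceptable candidates) refines $I$ iff $p_a\subseteq\ \succ_a$ for all $a$. Interviews. An interview is a mutually acceptable pair $(m,w)$; it is informative to both. Carrying out a set $T$ of interviews on $I$ yields an instance $I'$ exactly the same as $I$ except that each agent $a$ now strictly orders the candidates he/she interviewed: writing $T(a)$ for the candidates interviewed by $a$, $p'_a=p_a\cup L_a$, where $L_a$ is a strict total order on $T(a)$ and $p'_a$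 is acyclic; no other pairs are added. Such an $I'$ is an interview-compatible refinement of $I$, and its cost (given $I$) is the minimum $|T|$ over sets $T$ of interviews that refine $I$ into $I'$. Stability. A matching $\mu$ is a set of mutually acceptable pairs in which each agent appears at most once. $\mu$ is weakly stable if no acceptable pair $(m,w)\notin\mu$ is such that each of $m,w$ is unmatched or strictly prefers the other to his/her partner. A very weak blocking pair is an acceptable pair $(m,w)\notin\mu$ such that each of $m,w$ is unmatched, or strictly prefers the other to his/her partner, or cannot compare the other with his/her partner. $\mu$ is super-stable if it has no very weak blocking pair. Min-ICR-Exact. Input: $(I,\succ_{M,W},\mu)$ with $I$ an SMPI instance, $\succ_{M,W}$ a strict preference profile refining $I$, and $\mu$ a matching weakly stable w.r.t. $\succ_{M,W}$. Task: find an interview-compatible refinement $I'$ of $I$ such that (i) $\succ_{M,W}$ refines $I'$, (ii) $\mu$ is super-stable in $I'$, and (iii) $I'$ has minimum cost among interview-compatible refinements of $I$ satisfying (i) and (ii). *)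

theory Defs
  imports Complex_Main "HOL-Computational_Algebra.Polynomial"
begin

section \<open>Computation model\<close>

text \<open>
  Structured programs for a random access machine whose registers and memory cells
  hold natural numbers; the only arithmetic is addition and truncated subtraction.
  Every operation counts one step. As there is no multiplication, bit lengths grow by at
  most one per step, so polynomial time on this machine is polynomial time on Turing machines.
\<close>

datatype expr =
    Lit nat
  | Reg nat
  | Mem expr
  | Add expr expr
  | Sub expr expr

datatype prog =
    Skip
  | Assign nat expr
  | Store expr expr
  | Seq prog prog
  | Cond expr prog prog
  | While expr prog

type_synonym state = "(nat \<Rightarrow> nat) \<times> (nat \<Rightarrow> nat)"  \<comment> \<open>registers, memory\<close>

fun val :: "expr \<Rightarrow> state \<Rightarrow> nat" where
  "val (Lit k) s = k"
| "val (Reg r) s = fst s r"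
| "val (Mem e) s = snd s (val e s)"
| "val (Add e f) s = val e s + val f s"
| "val (Sub e f) s = val e s - val f s"

fun expr_time :: "expr \<Rightarrow> nat" where
  "expr_time (Lit k) = 1"
| "expr_time (Reg r) = 1"
| "expr_time (Mem e) = expr_time e + 1"
| "expr_time (Add e f) = expr_time e + expr_time f + 1"
| "expr_time (Sub e f) = expr_time e + expr_time f + 1"

text \<open>\<open>exec c s t s'\<close>: started in \<open>s\<close>, the program \<open>c\<close> halts in \<open>s'\<close> after exactly \<open>t\<close> steps.
  Conditions are true iff nonzero.\<close>

inductive exec :: "prog \<Rightarrow> state \<Rightarrow> nat \<Rightarrow> state \<Rightarrow> bool" where
  Skip: "exec Skip s 1 s"
| Assign: "exec (Assign r e) s (expr_time e + 1) ((fst s)(r := val e s), snd s)"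
| Store: "exec (Store e f) s (expr_time e + expr_time f + 1) (fst s, (snd s)(val e s := val f s))"
| Seq: "exec c s t s' \<Longrightarrow> exec d s' u s'' \<Longrightarrow> exec (Seq c d) s (t + u) s''"
| CondTrue: "val e s \<noteq> 0 \<Longrightarrow> exec c s t s' \<Longrightarrow> exec (Cond e c d) s (expr_time e + t + 1) s'"
| CondFalse: "val e s = 0 \<Longrightarrow> exec d s t s' \<Longrightarrow> exec (Cond e c d) s (expr_time e + t + 1) s'"
| WhileTrue: "val e s \<noteq> 0 \<Longrightarrow> exec c s t s' \<Longrightarrow> exec (While e c) s' u s'' \<Longrightarrow>
    exec (While e c) s (expr_time e + t + u + 1) s''"
| WhileFalse: "val e s = 0 \<Longrightarrow> exec (While e c) s (expr_time e + 1) s"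

inductive_cases SkipE: "exec Skip s t s'"
inductive_cases AssignE: "exec (Assign r e) s t s'"
inductive_cases StoreE: "exec (Store e f) s t s'"
inductive_cases SeqE: "exec (Seq c d) s t s'"
inductive_cases CondE: "exec (Cond e c d) s t s'"
inductive_cases WhileE: "exec (While e c) s t s'"

lemma exec_deterministic:
  "exec c s t s' \<Longrightarrow> exec c s u s'' \<Longrightarrow> t = u \<and> s' = s''"
proof (induction arbitrary: u s'' rule: exec.induct)
  case (Skip s)
  then show ?case by (rule SkipE) simp
next
  case (Assign r e s)
  then show ?case by (rule AssignE) simp
next
  case (Store e f s)
  then show ?case by (rule StoreE) simp
next
  case (Seq c s t s' d v r)
  show ?case
    by (rule SeqE[OF Seq.prems]) (metis Seq.IH)
next
  case (CondTrue e s c t s' d)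
  show ?case
    by (rule CondE[OF CondTrue.prems]) (simp_all add: CondTrue.hyps(1) CondTrue.IH)
next
  case (CondFalse e s d t s' c)
  show ?case
    by (rule CondE[OF CondFalse.prems]) (simp_all add: CondFalse.hyps(1) CondFalse.IH)
next
  case (WhileTrue e s c t s' v r)
  show ?case
  proof (rule WhileE[OF WhileTrue.prems])
    fix t1 s1 u1
    assume u: "u = Suc (expr_time e + t1 + u1)"
      and 1: "exec c s t1 s1" and 2: "exec (While e c) s1 u1 s''"
    from WhileTrue.IH(1)[OF 1] have eq: "t = t1" "s' = s1" by simp_all
    from WhileTrue.IH(2)[of u1 s''] 2 eq have "v = u1" "r = s''" by simp_all
    with u eq show ?thesis by simp
  next
    assume "val e s = 0"
    with WhileTrue.hyps(1) show ?thesis by simp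
  qed
next
  case (WhileFalse e s c)
  show ?case by (rule WhileE[OF WhileFalse.prems]) (simp_all add: WhileFalse.hyps(1))
qed

text \<open>A bit string is passed in memory cells \<open>0, 1, \<dots>\<close>, with its length in register \<open>0\<close>.\<close>

definition input_state :: "bool list \<Rightarrow> state" where
  "input_state xs =
     ((\<lambda>_. 0)(0 := length xs), \<lambda>i. if i < length xs then of_bool (xs ! i) else 0)"

definition output_is :: "state \<Rightarrow> bool list \<Rightarrow> bool" where
  "output_is s ys \<longleftrightarrow> fst s 0 = length ys \<and> (\<forall>i<length ys. snd s i = of_bool (ys ! i))"

text \<open>Search problems: \<open>valid\<close> singles out the admissible inputs, \<open>sol x y\<close> says that \<open>y\<close>
  is a correct answer for \<open>x\<close>.\<close>

definition solvable_in_polynomial_time ::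
  "('x \<Rightarrow> bool list) \<Rightarrow> ('y \<Rightarrow> bool list) \<Rightarrow> ('x \<Rightarrow> bool) \<Rightarrow> ('x \<Rightarrow> 'y \<Rightarrow> bool) \<Rightarrow> bool"
where
  "solvable_in_polynomial_time enc_in enc_out valid sol \<longleftrightarrow>
     (\<exists>(c::prog) (p::nat poly). \<forall>x. valid x \<longrightarrow>
        (\<exists>y t s. sol x y \<and> exec c (input_state (enc_in x)) t s \<and> output_is s (enc_out y) \<and>
                 t \<le> poly p (length (enc_in x))))"

section \<open>Instances\<close>

text \<open>
  Men and women are each numbered \<open>0, \<dots>, n - 1\<close>. A candidate of an agent is given by its
  number, its side being the opposite one. A set of (man, woman) pairs serves for
  acceptability, interviews and matchings alike; \<open>partners S a\<close> is the set of agents paired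
  with \<open>a\<close> in \<open>S\<close>.
\<close>

datatype agent = Man nat | Woman nat

type_synonym preferences = "agent \<Rightarrow> nat rel"

fun partners :: "(nat \<times> nat) set \<Rightarrow> agent \<Rightarrow> nat set" where
  "partners S (Man m) = {w. (m, w) \<in> S}"
| "partners S (Woman w) = {m. (m, w) \<in> S}"

record smp =
  num :: nat
  acc :: "(nat \<times> nat) set"
  pref :: preferences

definition strict_partial_order_of :: "'a set \<Rightarrow> 'a rel \<Rightarrow> bool" where
  "strict_partial_order_of A r \<longleftrightarrow> r \<subseteq> A \<times> A \<and> irrefl r \<and> trans r"

definition strict_total_order_of :: "'a set \<Rightarrow> 'a rel \<Rightarrow> bool" where
  "strict_total_order_of A r \<longleftrightarrow> r \<subseteq> A \<times> A \<and> strict_linear_order_on A r"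

text \<open>The quantifier over all agents is harmless: agents numbered \<open>n\<close> or more have no
  candidates and hence empty preference relations.\<close>

definition smpi :: "smp \<Rightarrow> bool" where
  "smpi I \<longleftrightarrow> acc I \<subseteq> {..<num I} \<times> {..<num I} \<and>
     (\<forall>a. strict_partial_order_of (partners (acc I) a) (pref I a))"

definition indifferent :: "smp \<Rightarrow> agent \<Rightarrow> nat rel" where
  "indifferent I a = {(c, d). c \<in> partners (acc I) a \<and> d \<in> partners (acc I) a \<and>
     (c, d) \<notin> pref I a \<and> (d, c) \<notin> pref I a}"

definition smti :: "smp \<Rightarrow> bool" where
  "smti I \<longleftrightarrow> smpi I \<and> (\<forall>a. trans (indifferent I a))"

definition indifference_classes :: "smp \<Rightarrow> agent \<Rightarrow> nat set set" where
  "indifference_classes I a = partners (acc I) a // indifferent I a"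

section \<open>Refinements and interviews\<close>

definition strict_profile :: "smp \<Rightarrow> preferences \<Rightarrow> bool" where
  "strict_profile I P \<longleftrightarrow> (\<forall>a. strict_total_order_of (partners (acc I) a) (P a))"

definition profile_refines :: "preferences \<Rightarrow> smp \<Rightarrow> bool" where
  "profile_refines P I \<longleftrightarrow> (\<forall>a. pref I a \<subseteq> P a)"

text \<open>No transitive closure is taken: exactly the orders on the interviewed candidates are added.\<close>

definition interviews_yield :: "smp \<Rightarrow> (nat \<times> nat) set \<Rightarrow> smp \<Rightarrow> bool" where
  "interviews_yield I T I' \<longleftrightarrow> T \<subseteq> acc I \<and> num I' = num I \<and> acc I' = acc I \<and>
     (\<forall>a. \<exists>L. strict_total_order_of (partners T a) L \<and>
              pref I' a = pref I a \<union> L \<and> acyclic (pref I' a))"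

definition interview_compatible_refinement :: "smp \<Rightarrow> smp \<Rightarrow> bool" where
  "interview_compatible_refinement I I' \<longleftrightarrow> (\<exists>T. interviews_yield I T I')"

definition cost :: "smp \<Rightarrow> smp \<Rightarrow> nat" where
  "cost I I' = (LEAST k. \<exists>T. interviews_yield I T I' \<and> card T = k)"

section \<open>Stability\<close>

definition matching :: "smp \<Rightarrow> (nat \<times> nat) set \<Rightarrow> bool" where
  "matching I \<mu> \<longleftrightarrow> \<mu> \<subseteq> acc I \<and> (\<forall>a. \<forall>c\<in>partners \<mu> a. \<forall>d\<in>partners \<mu> a. c = d)"

definition incomparable :: "smp \<Rightarrow> agent \<Rightarrow> nat \<Rightarrow> nat \<Rightarrow> bool" where
  "incomparable I a c d \<longleftrightarrow> c \<noteq> d \<and> (c, d) \<notin> pref I a \<and> (d, c) \<notin> pref I a"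

definition blocks :: "smp \<Rightarrow> (nat \<times> nat) set \<Rightarrow> agent \<Rightarrow> nat \<Rightarrow> bool" where
  "blocks I \<mu> a c \<longleftrightarrow> partners \<mu> a = {} \<or> (\<exists>d\<in>partners \<mu> a. (c, d) \<in> pref I a)"

definition blocks_very_weakly :: "smp \<Rightarrow> (nat \<times> nat) set \<Rightarrow> agent \<Rightarrow> nat \<Rightarrow> bool" where
  "blocks_very_weakly I \<mu> a c \<longleftrightarrow> partners \<mu> a = {} \<or>
     (\<exists>d\<in>partners \<mu> a. (c, d) \<in> pref I a \<or> incomparable I a c d)"

definition weakly_stable :: "smp \<Rightarrow> (nat \<times> nat) set \<Rightarrow> bool" where
  "weakly_stable I \<mu> \<longleftrightarrow> matching I \<mu> \<and>
     \<not> (\<exists>m w. (m, w) \<in> acc I - \<mu> \<and> blocks I \<mu> (Man m) w \<and> blocks I \<mu> (Woman w) m)"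

definition super_stable :: "smp \<Rightarrow> (nat \<times> nat) set \<Rightarrow> bool" where
  "super_stable I \<mu> \<longleftrightarrow> matching I \<mu> \<and>
     \<not> (\<exists>m w. (m, w) \<in> acc I - \<mu> \<and>
              blocks_very_weakly I \<mu> (Man m) w \<and> blocks_very_weakly I \<mu> (Woman w) m)"

section \<open>The problem Min-ICR-Exact\<close>

type_synonym icr_input = "smp \<times> preferences \<times> (nat \<times> nat) set"

definition min_icr_exact_input :: "icr_input \<Rightarrow> bool" where
  "min_icr_exact_input = (\<lambda>(I, P, \<mu>). smpi I \<and> strict_profile I P \<and> profile_refines P I \<and>
     weakly_stable (I\<lparr>pref := P\<rparr>) \<mu>)"

definition icr_exact_feasible :: "icr_input \<Rightarrow> smp \<Rightarrow> bool" where
  "icr_exact_feasible = (\<lambda>(I, P, \<mu>) I'. interview_compatible_refinement I I' \<and>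
     profile_refines P I' \<and> super_stable I' \<mu>)"

definition min_icr_exact_solution :: "icr_input \<Rightarrow> smp \<Rightarrow> bool" where
  "min_icr_exact_solution x I' \<longleftrightarrow> icr_exact_feasible x I' \<and>
     (\<forall>J. icr_exact_feasible x J \<longrightarrow> cost (fst x) I' \<le> cost (fst x) J)"

definition smti_ties_at_most_2 :: "smp \<Rightarrow> bool" where
  "smti_ties_at_most_2 I \<longleftrightarrow> smti I \<and> (\<forall>a. \<forall>C\<in>indifference_classes I a. card C \<le> 2)"

text \<open>All relations are encoded as \<open>n \<times> n\<close> Boolean matrices, row by row, after \<open>n\<close> in unary.
  On admissible inputs all relations live on \<open>{0, \<dots>, n - 1}\<close>, so nothing is lost.\<close>

definition enc_rel :: "nat \<Rightarrow> nat rel \<Rightarrow> bool list" where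
  "enc_rel n r = concat (map (\<lambda>i. map (\<lambda>j. (i, j) \<in> r) [0..<n]) [0..<n])"

definition enc_preferences :: "nat \<Rightarrow> preferences \<Rightarrow> bool list" where
  "enc_preferences n P = concat (map (\<lambda>i. enc_rel n (P (Man i))) [0..<n]) @
                         concat (map (\<lambda>i. enc_rel n (P (Woman i))) [0..<n])"

definition enc_smp :: "smp \<Rightarrow> bool list" where
  "enc_smp I = replicate (num I) True @ [False] @ enc_rel (num I) (acc I) @
               enc_preferences (num I) (pref I)"

definition enc_icr_input :: "icr_input \<Rightarrow> bool list" where
  "enc_icr_input = (\<lambda>(I, P, \<mu>). enc_smp I @ enc_preferences (num I) P @ enc_rel (num I) \<mu>)"

end

theory Submission
  imports Defs
begin

text \<open>
  If the interviews \<open>T\<close> are held, the refinement compatible with \<open>P\<close> is determined, and it makes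
  \<open>\<mu>\<close> super-stable iff each acceptable pair \<open>(m, w) \<notin> \<mu>\<close> not already rejected in \<open>I\<close> lies in \<open>T\<close>
  together with the matching edge of \<open>m\<close> (if \<open>m\<close> prefers his partner in \<open>P\<close>) or that of \<open>w\<close>
  (if she prefers hers). So these pairs are all forced, and what remains is a minimum vertex cover
  of a graph whose vertices are the edges of \<open>\<mu>\<close>. Directing it from the man's edge to the
  woman's, ties of size two give every vertex out-degree at most one. It is solved greedily,
  always covering the head of an uncovered arc whose tail has no uncovered incoming arc, or of any
  uncovered arc if there is none of this kind.
\<close>

section \<open>Reduction to a vertex cover problem\<close>

text \<open>Holding interviews adds no transitive consequences. Hence \<open>m\<close> learns that
  he prefers his partner \<open>x\<close> to \<open>w\<close> only by interviewing both, which is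
  why a needed pair costs its own interview besides that of a matching edge. Weak stability under
  \<open>P\<close> guarantees that at least one side rejects the pair. If exactly one side does, the
  matching edge to be interviewed is determined (\<open>forced\<close>); if both do, there is a
  choice, and this is an arc. Arcs leaving the edge of \<open>m\<close> come from women tied with
  his partner in \<open>I\<close>, and a tie of size two has room for one. This makes greed safe: a
  tail without uncovered incoming arcs covers only its own arc, so its head is at least as good; if
  every tail has one, counting tails and heads shows that the uncovered arcs form disjoint cycles,
  and a cover of a cycle can be rotated. The machine cannot multiply, so matrix addresses need
  precomputed tables. Every loop makes exactly \<open>n\<close> rounds, so a polynomial time bound
  can be read off the program text.\<close>

locale icr =
  fixes I :: smp and P :: preferences and \<mu> :: "(nat \<times> nat) set"
  assumes input: "min_icr_exact_input (I, P, \<mu>)"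
    and ties: "smti_ties_at_most_2 I"
begin

section \<open>Elementary properties of the profile and the matching\<close>

lemma acc_bound: "(m, w) \<in> acc I \<Longrightarrow> m < num I \<and> w < num I"
  using input by (auto simp: min_icr_exact_input_def smpi_def)

lemma finite_acc: "finite (acc I)"
proof (rule finite_subset)
  show "acc I \<subseteq> {..<num I} \<times> {..<num I}"
    using input by (simp add: min_icr_exact_input_def smpi_def)
qed simp

lemma pref_sub_P: "pref I a \<subseteq> P a"
  using input by (auto simp: min_icr_exact_input_def profile_refines_def)

lemma P_order: "P a \<subseteq> partners (acc I) a \<times> partners (acc I) a" "trans (P a)" "irrefl (P a)"
  "total_on (partners (acc I) a) (P a)"
  using input
  by (auto simp: min_icr_exact_input_def strict_profile_def strict_total_order_of_def
      strict_linear_order_on_def)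

lemma P_asym: "(c, d) \<in> P a \<Longrightarrow> (d, c) \<notin> P a"
  using P_order(2,3)[of a] by (meson irreflD transD)

lemma P_total: "c \<in> partners (acc I) a \<Longrightarrow> d \<in> partners (acc I) a \<Longrightarrow> c \<noteq> d \<Longrightarrow>
    (c, d) \<in> P a \<or> (d, c) \<in> P a"
  using P_order(4)[of a] by (auto simp: total_on_def)

lemma matching: "matching I \<mu>"
  using input by (auto simp: min_icr_exact_input_def weakly_stable_def matching_def)

lemma matching_acc: "\<mu> \<subseteq> acc I"
  using matching by (simp add: matching_def)

lemma matching_man: "(m, w) \<in> \<mu> \<Longrightarrow> (m, w') \<in> \<mu> \<Longrightarrow> w = w'"
  using matching unfolding matching_def by (metis partners.simps(1) mem_Collect_eq)

lemma matching_woman: "(m, w) \<in> \<mu> \<Longrightarrow> (m', w) \<in> \<mu> \<Longrightarrow> m = m'"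
  using matching unfolding matching_def by (metis partners.simps(2) mem_Collect_eq)

section \<open>Interview sets and the refinements they determine\<close>

definition refined :: "(nat \<times> nat) set \<Rightarrow> smp" where
  "refined T = I\<lparr>pref := \<lambda>a. pref I a \<union> {(c, d) \<in> P a. c \<in> partners T a \<and> d \<in> partners T a}\<rparr>"

lemma refined_simps [simp]: "num (refined T) = num I" "acc (refined T) = acc I"
  by (simp_all add: refined_def)

lemma pref_refined:
  "(c, d) \<in> pref (refined T) a \<longleftrightarrow>
     (c, d) \<in> pref I a \<or> (c, d) \<in> P a \<and> c \<in> partners T a \<and> d \<in> partners T a"
  by (auto simp: refined_def)

lemma pref_refined_sub_P: "pref (refined T) a \<subseteq> P a"
  using pref_sub_P[of a] by (auto simp: pref_refined)

lemma partners_mono: "S \<subseteq> T \<Longrightarrow> partners S a \<subseteq> partners T a"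
  by (cases a) auto

lemma interviews_yield_refined:
  assumes T: "T \<subseteq> acc I"
  shows "interviews_yield I T (refined T)"
proof -
  have "\<exists>L. strict_total_order_of (partners T a) L \<and>
      pref (refined T) a = pref I a \<union> L \<and> acyclic (pref (refined T) a)" for a
  proof (intro exI conjI)
    let ?L = "{(c, d) \<in> P a. c \<in> partners T a \<and> d \<in> partners T a}"
    have "trans ?L"
      using P_order(2)[of a] by (auto simp: trans_def)
    moreover have "irrefl ?L"
      using P_order(3)[of a] by (auto simp: irrefl_def)
    moreover have "total_on (partners T a) ?L"
      using P_order(4)[of a] partners_mono[OF T, of a] by (auto simp: total_on_def)
    ultimately show "strict_total_order_of (partners T a) ?L"
      by (auto simp: strict_total_order_of_def strict_linear_order_on_def)
    show "pref (refined T) a = pref I a \<union> ?L"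
      by (auto simp: pref_refined)
    have "acyclic (P a)"
      using P_order(2,3)[of a] by (simp add: acyclic_irrefl)
    then show "acyclic (pref (refined T) a)"
      using pref_refined_sub_P by (rule acyclic_subset)
  qed
  with T show ?thesis
    by (simp add: interviews_yield_def)
qed

text \<open>The order \<open>L\<close> added for an agent lies inside the asymmetric relation
  \<open>P a\<close> and is total on the interviewed candidates, so it can only be the restriction
  of \<open>P a\<close>. Feasible refinements can thus be traded for sets of interviews.\<close>

lemma interviews_yield_unique:
  assumes y: "interviews_yield I T I'" and r: "profile_refines P I'"
  shows "I' = refined T"
proof -
  have "pref I' a = pref (refined T) a" for a
  proof -
    obtain L where L: "strict_total_order_of (partners T a) L" "pref I' a = pref I a \<union> L"
      using y unfolding interviews_yield_def by blast
    have LP: "L \<subseteq> P a"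
      using r L by (auto simp: profile_refines_def)
    have "L = {(c, d) \<in> P a. c \<in> partners T a \<and> d \<in> partners T a}"
    proof
      show "L \<subseteq> {(c, d) \<in> P a. c \<in> partners T a \<and> d \<in> partners T a}"
        using L(1) LP by (auto simp: strict_total_order_of_def)
      show "{(c, d) \<in> P a. c \<in> partners T a \<and> d \<in> partners T a} \<subseteq> L"
      proof clarify
        fix c d assume cd: "(c, d) \<in> P a" "c \<in> partners T a" "d \<in> partners T a"
        then have "c \<noteq> d" "(d, c) \<notin> L"
          using P_asym LP by auto
        with cd L(1) show "(c, d) \<in> L"
          by (auto simp: strict_total_order_of_def strict_linear_order_on_def total_on_def)
      qed
    qed
    with L(2) show ?thesis
      unfolding refined_def by simp
  qed
  with y show ?thesis
    by (auto simp: interviews_yield_def intro!: smp.equality)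
qed

text \<open>These are the very weak blocking pairs of \<open>\<mu>\<close> in \<open>I\<close>
  itself, before any interview.\<close>

definition need :: "(nat \<times> nat) set" where
  "need = {(m, w) \<in> acc I - \<mu>. (\<nexists>x. (m, x) \<in> \<mu> \<and> (x, w) \<in> pref I (Man m)) \<and>
     (\<nexists>x. (x, w) \<in> \<mu> \<and> (x, m) \<in> pref I (Woman w))}"

lemma need_sub: "need \<subseteq> acc I - \<mu>"
  by (auto simp: need_def)

definition man_rejects :: "(nat \<times> nat) set" where
  "man_rejects = {(m, w). \<exists>x. (m, x) \<in> \<mu> \<and> (x, w) \<in> P (Man m)}"

definition woman_rejects :: "(nat \<times> nat) set" where
  "woman_rejects = {(m, w). \<exists>x. (x, w) \<in> \<mu> \<and> (x, m) \<in> P (Woman w)}"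

definition resolved :: "(nat \<times> nat) set \<Rightarrow> (nat \<times> nat) set" where
  "resolved T = {(m, w). (m, w) \<in> man_rejects \<and> (\<exists>x. (m, x) \<in> \<mu> \<inter> T) \<or>
     (m, w) \<in> woman_rejects \<and> (\<exists>x. (x, w) \<in> \<mu> \<inter> T)}"

definition resolving :: "(nat \<times> nat) set \<Rightarrow> bool" where
  "resolving T \<longleftrightarrow> T \<subseteq> acc I \<and> need \<subseteq> T \<and> need \<subseteq> resolved T"

text \<open>Outside \<open>\<mu>\<close> the candidate differs from the partner, and refined
  preferences inherit asymmetry from \<open>P\<close>; not blocking then leaves only a strict
  preference for the partner.\<close>

lemma not_blocks_very_weakly_man:
  assumes "(m, w) \<in> acc I - \<mu>"
  shows "\<not> blocks_very_weakly (refined T) \<mu> (Man m) w \<longleftrightarrow>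
    (\<exists>x. (m, x) \<in> \<mu> \<and> (x, w) \<in> pref (refined T) (Man m))"
  using assms matching_man[of m] P_asym[of _ _ "Man m"] pref_refined_sub_P[of T "Man m"]
  unfolding blocks_very_weakly_def incomparable_def by simp blast

lemma not_blocks_very_weakly_woman:
  assumes "(m, w) \<in> acc I - \<mu>"
  shows "\<not> blocks_very_weakly (refined T) \<mu> (Woman w) m \<longleftrightarrow>
    (\<exists>x. (x, w) \<in> \<mu> \<and> (x, m) \<in> pref (refined T) (Woman w))"
  using assms matching_woman[of _ w] P_asym[of _ _ "Woman w"] pref_refined_sub_P[of T "Woman w"]
  unfolding blocks_very_weakly_def incomparable_def by simp blast

text \<open>A new comparison of the partner with the other side of the pair puts two interviews into
  \<open>T\<close>: the pair itself, whichever side rejects it, whence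
  \<open>need \<subseteq> T\<close>, and the matching edge of the rejecting side, whence
  \<open>resolved T\<close>.\<close>

lemma super_stable_refined:
  assumes T: "T \<subseteq> acc I"
  shows "super_stable (refined T) \<mu> \<longleftrightarrow> resolving T"
proof -
  have "(\<exists>x. (m, x) \<in> \<mu> \<and> (x, w) \<in> pref (refined T) (Man m)) \<or>
        (\<exists>x. (x, w) \<in> \<mu> \<and> (x, m) \<in> pref (refined T) (Woman w)) \<longleftrightarrow>
        ((m, w) \<in> need \<longrightarrow> (m, w) \<in> T \<and> (m, w) \<in> resolved T)"
    if "(m, w) \<in> acc I - \<mu>" for m w
    using that matching_man[of m] matching_woman[of _ w]
    by (simp add: pref_refined need_def resolved_def man_rejects_def woman_rejects_def) metis
  moreover have "matching (refined T) \<mu>"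
    using matching by (simp add: matching_def)
  ultimately have "super_stable (refined T) \<mu> \<longleftrightarrow>
      (\<forall>m w. (m, w) \<in> acc I - \<mu> \<longrightarrow> (m, w) \<in> need \<longrightarrow> (m, w) \<in> T \<and> (m, w) \<in> resolved T)"
    using not_blocks_very_weakly_man[of _ _ T] not_blocks_very_weakly_woman[of _ _ T]
    unfolding super_stable_def refined_simps by meson
  then show ?thesis
    using T need_sub unfolding resolving_def by auto
qed

definition optimal :: "(nat \<times> nat) set \<Rightarrow> bool" where
  "optimal T \<longleftrightarrow> resolving T \<and> (\<forall>T'. resolving T' \<longrightarrow> card T \<le> card T')"

text \<open>Different interview sets can yield the same refinement, so \<open>card T\<close> only
  bounds the cost of \<open>refined T\<close> from above. For a competitor \<open>J\<close> the cost
  is attained by some \<open>T'\<close>, and super-stability of \<open>J\<close> makes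
  \<open>T'\<close> resolving.\<close>

lemma min_icr_exact_solution_refined:
  assumes "optimal T"
  shows "min_icr_exact_solution (I, P, \<mu>) (refined T)"
proof -
  have T: "T \<subseteq> acc I" "resolving T"
    using assms by (auto simp: optimal_def resolving_def)
  have y: "interviews_yield I T (refined T)"
    using T(1) by (rule interviews_yield_refined)
  have "icr_exact_feasible (I, P, \<mu>) (refined T)"
    using y T super_stable_refined[of T] pref_refined_sub_P
    by (auto simp: icr_exact_feasible_def interview_compatible_refinement_def profile_refines_def)
  moreover have "cost I (refined T) \<le> cost I J" if J: "icr_exact_feasible (I, P, \<mu>) J" for J
  proof -
    have "\<exists>T'. interviews_yield I T' J"
      using J by (simp add: icr_exact_feasible_def interview_compatible_refinement_def)
    then have "\<exists>k T'. interviews_yield I T' J \<and> card T' = k"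
      by blast
    then have "\<exists>T'. interviews_yield I T' J \<and> card T' = cost I J"
      unfolding cost_def by (rule LeastI_ex)
    then obtain T' where T': "interviews_yield I T' J" "card T' = cost I J"
      by blast
    then have "J = refined T'"
      using J interviews_yield_unique by (simp add: icr_exact_feasible_def)
    with J T' have "resolving T'"
      using super_stable_refined[of T'] by (simp add: icr_exact_feasible_def interviews_yield_def)
    with assms have "card T \<le> card T'"
      by (simp add: optimal_def)
    moreover have "cost I (refined T) \<le> card T"
      unfolding cost_def by (rule Least_le) (use y in blast)
    ultimately show ?thesis
      using T' by simp
  qed
  ultimately show ?thesis
    by (simp add: min_icr_exact_solution_def)
qed

text \<open>Since \<open>P\<close> is total, an agent who does not block is matched and strictly
  prefers the partner. This makes \<open>acc I\<close> resolving, so an optimum exists.\<close>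

lemma weakly_stable_rejects: "acc I - \<mu> \<subseteq> man_rejects \<union> woman_rejects"
proof clarify
  fix m w assume mw: "(m, w) \<in> acc I" "(m, w) \<notin> \<mu>" "(m, w) \<notin> woman_rejects"
  have "\<not> blocks (I\<lparr>pref := P\<rparr>) \<mu> (Man m) w \<or> \<not> blocks (I\<lparr>pref := P\<rparr>) \<mu> (Woman w) m"
    using input mw by (auto simp: min_icr_exact_input_def weakly_stable_def)
  moreover have "blocks (I\<lparr>pref := P\<rparr>) \<mu> (Woman w) m"
  proof (rule ccontr)
    assume "\<not> blocks (I\<lparr>pref := P\<rparr>) \<mu> (Woman w) m"
    then obtain x where x: "(x, w) \<in> \<mu>" "(m, x) \<notin> P (Woman w)"
      by (auto simp: blocks_def)
    then have "(x, m) \<in> P (Woman w)"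
      using P_total[of x "Woman w" m] mw matching_acc by auto
    with x mw show False
      by (auto simp: woman_rejects_def)
  qed
  ultimately obtain x where x: "(m, x) \<in> \<mu>" "(w, x) \<notin> P (Man m)"
    by (auto simp: blocks_def)
  then have "(x, w) \<in> P (Man m)"
    using P_total[of x "Man m" w] mw matching_acc by auto
  with x show "(m, w) \<in> man_rejects"
    by (auto simp: man_rejects_def)
qed

lemma resolving_acc: "resolving (acc I)"
proof -
  have "man_rejects \<union> woman_rejects \<subseteq> resolved (acc I)"
    using matching_acc by (auto simp: resolved_def man_rejects_def woman_rejects_def)
  then show ?thesis
    using weakly_stable_rejects need_sub by (auto simp: resolving_def)
qed

lemma ex_optimal: "\<exists>T. optimal T"
  using ex_has_least_nat[of resolving "acc I" card] resolving_acc by (auto simp: optimal_def)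

text \<open>Out-degree at most one. Membership in \<open>need\<close> keeps \<open>(x, w)\<close>
  out of \<open>pref I\<close>, and the rejection in \<open>P\<close> keeps \<open>(w, x)\<close>
  out, so \<open>w\<close> is tied with the partner \<open>x\<close>. A second such woman would make
  the tie have three members.\<close>

lemma need_man_unique:
  assumes "(m, w) \<in> need \<inter> man_rejects" "(m, w') \<in> need \<inter> man_rejects"
  shows "w = w'"
proof (rule ccontr)
  assume neq: "w \<noteq> w'"
  obtain x where x: "(m, x) \<in> \<mu>" "(x, w) \<in> P (Man m)"
    using assms by (auto simp: man_rejects_def)
  then have x': "(x, w') \<in> P (Man m)"
    using assms matching_man by (auto simp: man_rejects_def)
  let ?C = "indifferent I (Man m) `` {x}"
  have "?C \<in> indifference_classes I (Man m)"
    using x matching_acc by (auto simp: indifference_classes_def intro!: quotientI)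
  then have "card ?C \<le> 2"
    using ties by (simp add: smti_ties_at_most_2_def)
  moreover have "{x, w, w'} \<subseteq> ?C"
    using x x' assms matching_acc pref_sub_P P_asym
    by (auto simp: indifferent_def need_def) blast+
  moreover have "?C \<subseteq> {..<num I}"
    by (auto simp: indifferent_def dest: acc_bound)
  then have "finite ?C"
    by (rule finite_subset) simp
  moreover have "x \<noteq> w" "x \<noteq> w'"
    using x assms by (auto simp: need_def)
  then have "card {x, w, w'} = 3"
    using neq by simp
  ultimately show False
    using card_mono[of ?C "{x, w, w'}"] by simp
qed

text \<open>If one side does not reject the pair in \<open>P\<close>, only the matching edge of the
  other side can resolve it. The empty value outside \<open>need\<close> lets \<open>initial\<close>
  range over the full grid, as the loop computing it does.\<close>

definition forced :: "nat \<times> nat \<Rightarrow> (nat \<times> nat) set" where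
  "forced = (\<lambda>(m, w). if (m, w) \<in> need
     then {(m, w)} \<union> {(x, w') \<in> \<mu>. w' = w \<and> (m, w) \<notin> man_rejects} \<union>
          {(m', x) \<in> \<mu>. m' = m \<and> (m, w) \<notin> woman_rejects}
     else {})"

lemma forced_sub:
  assumes "resolving T"
  shows "forced (m, w) \<subseteq> T"
proof (cases "(m, w) \<in> need")
  case True
  then have T: "(m, w) \<in> T" "(m, w) \<in> resolved T"
    using assms by (auto simp: resolving_def)
  then have "{(x, w') \<in> \<mu>. w' = w \<and> (m, w) \<notin> man_rejects} \<subseteq> T"
    using matching_woman by (auto simp: resolved_def)
  moreover have "{(m', x) \<in> \<mu>. m' = m \<and> (m, w) \<notin> woman_rejects} \<subseteq> T"
    using T matching_man by (auto simp: resolved_def)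
  ultimately show ?thesis
    using T by (auto simp: forced_def)
qed (simp add: forced_def)

definition unresolved :: "(nat \<times> nat) set \<Rightarrow> (nat \<times> nat) set" where
  "unresolved T = {(m, w) \<in> need. (\<nexists>x. (m, x) \<in> \<mu> \<inter> T) \<and> (\<nexists>x. (x, w) \<in> \<mu> \<inter> T)}"

definition initial :: "(nat \<times> nat) set" where
  "initial = \<Union> (forced ` ({..<num I} \<times> {..<num I}))"

lemma forced_initial: "(m, w) \<in> need \<Longrightarrow> forced (m, w) \<subseteq> initial"
  using need_sub acc_bound[of m w] by (auto simp: initial_def)

text \<open>If one side did not reject, the matching edge of the other would be forced and so
  already in \<open>T\<close>, and the pair would be covered. Beyond \<open>initial\<close>,
  uncovered pairs are therefore genuine arcs with a matching edge at both ends.\<close>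

lemma unresolved_rejects:
  assumes T: "initial \<subseteq> T" and mw: "(m, w) \<in> unresolved T"
  shows "(m, w) \<in> man_rejects" "(m, w) \<in> woman_rejects"
proof -
  have need: "(m, w) \<in> need" and f: "forced (m, w) \<subseteq> T"
    using mw T forced_initial[of m w] by (auto simp: unresolved_def)
  then have or: "(m, w) \<in> man_rejects \<or> (m, w) \<in> woman_rejects"
    using need_sub weakly_stable_rejects by blast
  show "(m, w) \<in> man_rejects"
  proof (rule ccontr)
    assume "(m, w) \<notin> man_rejects"
    then obtain x where "(x, w) \<in> \<mu>" "(x, w) \<in> forced (m, w)"
      using or need by (auto simp: woman_rejects_def forced_def)
    with f mw show False
      by (auto simp: unresolved_def)
  qed
  show "(m, w) \<in> woman_rejects"
  proof (rule ccontr)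
    assume "(m, w) \<notin> woman_rejects"
    then obtain x where "(m, x) \<in> \<mu>" "(m, x) \<in> forced (m, w)"
      using or need by (auto simp: man_rejects_def forced_def)
    with f mw show False
      by (auto simp: unresolved_def)
  qed
qed

lemma resolved_if_not_unresolved:
  assumes T: "initial \<subseteq> T" and mw: "(m, w) \<in> need" "(m, w) \<notin> unresolved T"
  shows "(m, w) \<in> resolved T"
proof -
  have f: "forced (m, w) \<subseteq> T"
    using mw T forced_initial[of m w] by auto
  have or: "(m, w) \<in> man_rejects \<or> (m, w) \<in> woman_rejects"
    using mw need_sub weakly_stable_rejects by blast
  consider "(m, w) \<notin> man_rejects" | "(m, w) \<notin> woman_rejects"
    | "(m, w) \<in> man_rejects" "(m, w) \<in> woman_rejects"
    by blast
  then show ?thesis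
  proof cases
    case 1
    then obtain x where "(x, w) \<in> \<mu>" "(x, w) \<in> forced (m, w)"
      using or mw by (auto simp: woman_rejects_def forced_def)
    with 1 or f show ?thesis
      by (auto simp: resolved_def)
  next
    case 2
    then obtain x where "(m, x) \<in> \<mu>" "(m, x) \<in> forced (m, w)"
      using or mw by (auto simp: man_rejects_def forced_def)
    with 2 or f show ?thesis
      by (auto simp: resolved_def)
  next
    case 3
    with mw show ?thesis
      by (auto simp: resolved_def unresolved_def)
  qed
qed

lemma resolved_mono: "S \<subseteq> T \<Longrightarrow> resolved S \<subseteq> resolved T"
  by (auto simp: resolved_def)

text \<open>The greedy invariant is extendability to an optimum. The bound
  \<open>T \<subseteq> need \<union> \<mu>\<close>, together with
  \<open>need \<subseteq> initial\<close>, gives \<open>T - \<mu> = need\<close>, so the program can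
  recognise needed pairs from the interview matrix.\<close>

definition partial_solution :: "(nat \<times> nat) set \<Rightarrow> bool" where
  "partial_solution T \<longleftrightarrow> initial \<subseteq> T \<and> T \<subseteq> need \<union> \<mu> \<and> (\<exists>C. optimal C \<and> T \<subseteq> C)"

lemma partial_solution_initial: "partial_solution initial"
proof -
  obtain C where C: "optimal C"
    using ex_optimal by blast
  have "initial \<subseteq> need \<union> \<mu>"
    by (auto simp: initial_def forced_def split: if_splits)
  moreover have "initial \<subseteq> C"
    using C forced_sub[of C] by (auto simp: initial_def optimal_def)
  ultimately show ?thesis
    using C by (auto simp: partial_solution_def)
qed

lemma need_sub_initial: "need \<subseteq> initial"
proof clarify
  fix m w assume "(m, w) \<in> need"
  with forced_initial[of m w] show "(m, w) \<in> initial"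
    by (auto simp: forced_def)
qed

lemma finite_resolving: "resolving T \<Longrightarrow> finite T"
  using finite_acc by (auto simp: resolving_def intro: rev_finite_subset)

lemma optimal_if_all_resolved:
  assumes T: "partial_solution T" and "unresolved T = {}"
  shows "optimal T"
proof -
  obtain C where C: "optimal C" "T \<subseteq> C"
    using T by (auto simp: partial_solution_def)
  have "resolving T"
    using T need_sub_initial resolved_if_not_unresolved[of T] need_sub matching_acc assms(2)
    by (auto simp: partial_solution_def resolving_def)
  moreover have "card T \<le> card C"
    using C finite_resolving by (auto simp: optimal_def intro: card_mono)
  ultimately show ?thesis
    using C(1) by (auto simp: optimal_def intro: order_trans)
qed

text \<open>The vertex in question is the matching edge \<open>(m, y)\<close> of \<open>m\<close>;
  the arc of a pair \<open>(x, y)\<close> ends there because this is also the matching edge of woman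
  \<open>y\<close>.\<close>

definition source :: "(nat \<times> nat) set \<Rightarrow> nat \<Rightarrow> bool" where
  "source T m \<longleftrightarrow> (\<nexists>x y. (m, y) \<in> \<mu> \<and> (x, y) \<in> unresolved T)"

text \<open>The edge condition of vertex cover, for the arc with tail \<open>(m, y)\<close> and head
  \<open>(x, w)\<close>.\<close>

lemma unresolved_covered:
  assumes C: "resolving C" and mw: "(m, w) \<in> unresolved T" and x: "(x, w) \<in> \<mu>" "(x, w) \<notin> C"
    and y: "(m, y) \<in> \<mu>"
  shows "(m, y) \<in> C"
proof -
  have "(m, w) \<in> resolved C"
    using C mw by (auto simp: resolving_def unresolved_def)
  moreover have "z = y" if "(m, z) \<in> \<mu>" for z
    using that y by (rule matching_man)
  moreover have "z = x" if "(z, w) \<in> \<mu>" for z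
    using that x(1) by (rule matching_woman)
  ultimately show ?thesis
    using x(2) unfolding resolved_def by blast
qed

text \<open>In an optimal solution, the tail of the arc can be exchanged for its head: every other
  pair that relied on the tail is already resolved in \<open>T\<close>.\<close>

lemma partial_solution_insert_source:
  assumes T: "partial_solution T" and mw: "(m, w) \<in> unresolved T" and x: "(x, w) \<in> \<mu>"
    and src: "source T m"
  shows "partial_solution (insert (x, w) T)"
proof -
  obtain C where C: "optimal C" "T \<subseteq> C"
    using T by (auto simp: partial_solution_def)
  have init: "initial \<subseteq> T"
    using T by (simp add: partial_solution_def)
  obtain y where y: "(m, y) \<in> \<mu>"
    using unresolved_rejects(1)[OF init mw] by (auto simp: man_rejects_def)
  have rC: "resolving C"
    using C by (simp add: optimal_def)
  have yT: "(m, y) \<notin> T"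
    using y mw by (auto simp: unresolved_def)
  have "\<exists>C'. optimal C' \<and> insert (x, w) T \<subseteq> C'"
  proof (cases "(x, w) \<in> C")
    case True
    with C show ?thesis by blast
  next
    case False
    let ?C = "insert (x, w) (C - {(m, y)})"
    have yC: "(m, y) \<in> C"
      using unresolved_covered[OF rC mw x False y] .
    have "resolving ?C"
      unfolding resolving_def
    proof (intro conjI subsetI)
      show "p \<in> acc I" if "p \<in> ?C" for p
        using that x matching_acc rC by (auto simp: resolving_def)
      show "p \<in> ?C" if "p \<in> need" for p
        using that y need_sub rC by (auto simp: resolving_def)
      fix p assume p: "p \<in> need"
      obtain m' w' where mw': "p = (m', w')"
        by (cases p)
      have res: "(m', w') \<in> resolved C"
        using p rC mw' by (auto simp: resolving_def)
      show "p \<in> resolved ?C"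
      proof (cases "(m', w') \<in> unresolved T")
        case False
        then have "(m', w') \<in> resolved T"
          using resolved_if_not_unresolved[OF init] p mw' by blast
        moreover have "T \<subseteq> ?C"
          using C yT by blast
        ultimately show ?thesis
          using resolved_mono[of T ?C] mw' by blast
      next
        case True
        note rej = unresolved_rejects[OF init True]
        show ?thesis
        proof (cases "m' = m")
          case True
          \<comment> \<open>The only arc leaving the removed tail is \<open>(m, w)\<close> itself,
            and its head has been added.\<close>
          then have "w' = w"
            using need_man_unique[of m w w'] rej p mw' mw unresolved_rejects[OF init mw]
            by (auto simp: unresolved_def)
          with rej x mw' show ?thesis
            by (auto simp: resolved_def)
        next
          case False
          have "(m', w') \<in> unresolved T" by fact
          \<comment> \<open>An uncovered arc into \<open>(m, y)\<close> would contradict that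
            \<open>m\<close> is a source, so this pair is resolved in \<open>C\<close> by some other
            edge.\<close>
          then have "w' \<noteq> y"
            using src y by (auto simp: source_def)
          with False res mw' show ?thesis
            by (auto simp: resolved_def)
        qed
      qed
    qed
    moreover have "card ?C \<le> card C"
      using card_Suc_Diff1[OF finite_resolving[OF rC] yC] card_insert_le_m1[of "card C"]
      by (metis card_insert_if finite_Diff finite_resolving[OF rC] le_SucI order_refl)
    ultimately have "optimal ?C"
      using C(1) by (auto simp: optimal_def intro: order_trans)
    moreover have "insert (x, w) T \<subseteq> ?C"
      using C yT by blast
    ultimately show ?thesis by blast
  qed
  then show ?thesis
    using T x by (auto simp: partial_solution_def)
qed

text \<open>Without sources, each tail of an unresolved arc is also a head. Moving the part of an
  optimal solution that lies on the tails one step forward along the arcs yields another solution,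
  which is no larger, and which contains the head of every arc whose tail was chosen.\<close>

lemma partial_solution_insert_cycle:
  assumes T: "partial_solution T" and mw: "(m, w) \<in> unresolved T" and x: "(x, w) \<in> \<mu>"
    and cyc: "\<And>m w. (m, w) \<in> unresolved T \<Longrightarrow> \<not> source T m"
  shows "partial_solution (insert (x, w) T)"
proof -
  obtain C where C: "optimal C" "T \<subseteq> C"
    using T by (auto simp: partial_solution_def)
  have init: "initial \<subseteq> T"
    using T by (simp add: partial_solution_def)
  obtain y where y: "(m, y) \<in> \<mu>"
    using unresolved_rejects(1)[OF init mw] by (auto simp: man_rejects_def)
  have rC: "resolving C"
    using C by (simp add: optimal_def)
  have "\<exists>C'. optimal C' \<and> insert (x, w) T \<subseteq> C'"
  proof (cases "(x, w) \<in> C")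
    case True
    with C show ?thesis by blast
  next
    case False
    \<comment> \<open>\<open>E\<close> holds the tails of all uncovered arcs, \<open>N\<close> the
      heads of those arcs whose tail lies in \<open>C\<close>; \<open>?C\<close> is the rotated
      solution.\<close>
    define E where "E = {(m, y) \<in> \<mu>. m \<in> Domain (unresolved T)}"
    define N where "N = {(x, w) \<in> \<mu>. \<exists>m y. (m, w) \<in> unresolved T \<and> (m, y) \<in> \<mu> \<inter> C}"
    let ?C = "(C - E) \<union> N"
    have ET: "E \<inter> T = {}"
      by (auto simp: E_def unresolved_def)
    have "resolving ?C"
      unfolding resolving_def
    proof (intro conjI subsetI)
      show "p \<in> acc I" if "p \<in> ?C" for p
        using that matching_acc rC by (auto simp: resolving_def N_def)
      show "p \<in> ?C" if "p \<in> need" for p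
        using that need_sub rC by (auto simp: resolving_def E_def)
      fix p assume p: "p \<in> need"
      obtain m' w' where mw': "p = (m', w')"
        by (cases p)
      show "p \<in> resolved ?C"
      proof (cases "(m', w') \<in> unresolved T")
        case False
        then have "(m', w') \<in> resolved T"
          using resolved_if_not_unresolved[OF init] p mw' by blast
        moreover have "T \<subseteq> ?C"
          using C ET by blast
        ultimately show ?thesis
          using resolved_mono[of T ?C] mw' by blast
      next
        case True
        note rej = unresolved_rejects[OF init True]
        \<comment> \<open>Since \<open>m'\<close> is no source, the tail \<open>(m', y')\<close> of
          its arc is the head of a preceding arc \<open>(u, y')\<close>.\<close>
        obtain y' u where y': "(m', y') \<in> \<mu>" "(u, y') \<in> unresolved T"
          using cyc[OF True] by (auto simp: source_def)
        obtain x' where x': "(x', w') \<in> \<mu>"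
          using rej by (auto simp: woman_rejects_def)
        obtain z where z: "(u, z) \<in> \<mu>"
          using unresolved_rejects[OF init y'(2)] by (auto simp: man_rejects_def)
        show ?thesis
        proof (cases "(m', y') \<in> C")
          case True
          then have "(x', w') \<in> N"
            using x' y' \<open>(m', w') \<in> unresolved T\<close> by (auto simp: N_def)
          with x' rej mw' show ?thesis
            by (auto simp: resolved_def)
        next
          case False
          \<comment> \<open>The preceding arc is covered by \<open>C\<close> but not at its head,
            hence at its tail; rotation then moves the choice to \<open>(m', y')\<close>.\<close>
          then have "(u, z) \<in> C"
            using unresolved_covered[OF rC y'(2) y'(1) _ z] by blast
          then have "(m', y') \<in> N"
            using y' z by (auto simp: N_def)
          with y' rej mw' show ?thesis
            by (auto simp: resolved_def)
        qed
      qed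
    qed
    moreover have "card ?C \<le> card C"
    proof -
      have fin: "finite C"
        using finite_resolving[OF rC] .
      \<comment> \<open>\<open>g\<close> sends the tail of an arc to its head, which is well defined
        by out-degree at most one. Every edge of \<open>N\<close> is the image of a removed
        edge.\<close>
      define g where "g = (\<lambda>(m::nat, y::nat). let w = (THE w. (m, w) \<in> unresolved T) in (THE x. (x, w) \<in> \<mu>, w))"
      have "N \<subseteq> g ` (C \<inter> E)"
      proof clarify
        fix x w assume "(x, w) \<in> N"
        then obtain m y where *: "(x, w) \<in> \<mu>" "(m, w) \<in> unresolved T" "(m, y) \<in> \<mu>" "(m, y) \<in> C"
          by (auto simp: N_def)
        have "(THE w. (m, w) \<in> unresolved T) = w"
          using *(2) need_man_unique[of m] unresolved_rejects(1)[OF init]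
          by (intro the_equality) (auto simp: unresolved_def)
        moreover have "(THE x. (x, w) \<in> \<mu>) = x"
          using *(1) matching_woman by blast
        ultimately have "g (m, y) = (x, w)"
          by (simp add: g_def)
        moreover have "(m, y) \<in> C \<inter> E"
          using * by (auto simp: E_def)
        ultimately show "(x, w) \<in> g ` (C \<inter> E)"
          by force
      qed
      then have "card N \<le> card (C \<inter> E)"
        using fin by (meson card_image_le card_mono finite_Int finite_imageI order_trans)
      moreover have "card C = card (C - E) + card (C \<inter> E)"
        using card_Diff_subset_Int[of C E] fin card_mono[of C "C \<inter> E"] by simp
      ultimately show ?thesis
        using card_Un_le[of "C - E" N] by linarith
    qed
    ultimately have "optimal ?C"
      using C(1) by (auto simp: optimal_def intro: order_trans)
    \<comment> \<open>As the head \<open>(x, w)\<close> is missing from \<open>C\<close>, the tail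
      \<open>(m, y)\<close> is in \<open>C\<close>, and so the head enters \<open>N\<close>.\<close>
    moreover have "insert (x, w) T \<subseteq> ?C"
      using C ET x y mw unresolved_covered[OF rC mw x False y] by (auto simp: N_def)
    ultimately show ?thesis by blast
  qed
  then show ?thesis
    using T x by (auto simp: partial_solution_def)
qed

end

section \<open>Running time by program structure\<close>

text \<open>\<open>time_poly c\<close> bounds the running time in terms of a common bound on the number of
  iterations of every loop. This bound is the parameter \<open>N\<close> of \<open>hoare\<close>.\<close>

fun time_poly :: "prog \<Rightarrow> nat poly" where
  "time_poly Skip = [:1:]"
| "time_poly (Assign r e) = [:expr_time e + 1:]"
| "time_poly (Store e f) = [:expr_time e + expr_time f + 1:]"
| "time_poly (Seq c d) = time_poly c + time_poly d"
| "time_poly (Cond e c d) = [:expr_time e + 1:] + time_poly c + time_poly d"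
| "time_poly (While e c) = [:0, 1:] * (time_poly c + [:expr_time e + 1:]) + [:expr_time e + 1:]"

definition hoare :: "nat \<Rightarrow> (state \<Rightarrow> bool) \<Rightarrow> prog \<Rightarrow> (state \<Rightarrow> bool) \<Rightarrow> bool" where
  "hoare N A c B \<longleftrightarrow>
     (\<forall>s. A s \<longrightarrow> (\<exists>t s'. exec c s t s' \<and> t \<le> poly (time_poly c) N \<and> B s'))"

fun loop_free :: "prog \<Rightarrow> bool" where
  "loop_free (Seq c d) \<longleftrightarrow> loop_free c \<and> loop_free d"
| "loop_free (Cond e c d) \<longleftrightarrow> loop_free c \<and> loop_free d"
| "loop_free (While e c) \<longleftrightarrow> False"
| "loop_free _ \<longleftrightarrow> True"

text \<open>A functional semantics, so that loop-free code can be verified by simplification. The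
  \<open>While\<close> equation is a dummy value, excluded by \<open>loop_free\<close> in
  \<open>exec_run\<close>.\<close>

fun run :: "prog \<Rightarrow> state \<Rightarrow> state" where
  "run Skip s = s"
| "run (Assign r e) s = ((fst s)(r := val e s), snd s)"
| "run (Store e f) s = (fst s, (snd s)(val e s := val f s))"
| "run (Seq c d) s = run d (run c s)"
| "run (Cond e c d) s = (if val e s \<noteq> 0 then run c s else run d s)"
| "run (While e c) s = s"

lemma exec_run: "loop_free c \<Longrightarrow> \<exists>t. exec c s t (run c s) \<and> t \<le> poly (time_poly c) N"
proof (induction c arbitrary: s)
  case Skip
  show ?case by (auto intro!: exI exec.Skip)
next
  case (Assign r e)
  show ?case by (auto intro!: exI exec.Assign[simplified])
next
  case (Store e f)
  show ?case by (auto intro!: exI exec.Store[simplified])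
next
  case (Seq c d)
  obtain t where t: "exec c s t (run c s)" "t \<le> poly (time_poly c) N"
    using Seq.IH(1)[of s] Seq.prems by auto
  obtain u where u: "exec d (run c s) u (run d (run c s))" "u \<le> poly (time_poly d) N"
    using Seq.IH(2)[of "run c s"] Seq.prems by auto
  show ?case
    using t u exec.Seq[OF t(1) u(1)] by (intro exI[of _ "t + u"]) simp
next
  case (Cond e c d)
  show ?case
  proof (cases "val e s = 0")
    case True
    obtain t where "exec d s t (run d s)" "t \<le> poly (time_poly d) N"
      using Cond.IH(2)[of s] Cond.prems by auto
    with True show ?thesis
      using exec.CondFalse[OF True, of d t "run d s" c] by (intro exI[of _ "expr_time e + t + 1"]) auto
  next
    case False
    obtain t where "exec c s t (run c s)" "t \<le> poly (time_poly c) N"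
      using Cond.IH(1)[of s] Cond.prems by auto
    with False show ?thesis
      using exec.CondTrue[OF False, of c t "run c s" d] by (intro exI[of _ "expr_time e + t + 1"]) auto
  qed
qed simp

lemma hoare_run: "loop_free c \<Longrightarrow> (\<And>s. A s \<Longrightarrow> B (run c s)) \<Longrightarrow> hoare N A c B"
  using exec_run unfolding hoare_def by blast

lemma hoare_weaken:
  "hoare N A c B \<Longrightarrow> (\<And>s. A' s \<Longrightarrow> A s) \<Longrightarrow> (\<And>s. B s \<Longrightarrow> B' s) \<Longrightarrow> hoare N A' c B'"
  unfolding hoare_def by blast

lemma hoare_Seq:
  assumes "hoare N A c B" "hoare N B d C"
  shows "hoare N A (Seq c d) C"
  unfolding hoare_def
proof (intro allI impI)
  fix s assume "A s"
  then obtain t s' where 1: "exec c s t s'" "t \<le> poly (time_poly c) N" "B s'"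
    using assms(1) unfolding hoare_def by blast
  then obtain u s'' where 2: "exec d s' u s''" "u \<le> poly (time_poly d) N" "C s''"
    using assms(2) unfolding hoare_def by metis
  show "\<exists>t s'. exec (Seq c d) s t s' \<and> t \<le> poly (time_poly (Seq c d)) N \<and> C s'"
    using 1 2 exec.Seq[OF 1(1) 2(1)] by (intro exI[of _ "t + u"] exI[of _ s'']) simp
qed

lemma hoare_Cond:
  assumes c: "hoare N (\<lambda>s. A s \<and> val e s \<noteq> 0) c B" and d: "hoare N (\<lambda>s. A s \<and> val e s = 0) d B"
  shows "hoare N A (Cond e c d) B"
  unfolding hoare_def
proof (intro allI impI)
  fix s assume A: "A s"
  show "\<exists>t s'. exec (Cond e c d) s t s' \<and> t \<le> poly (time_poly (Cond e c d)) N \<and> B s'"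
  proof (cases "val e s = 0")
    case True
    then obtain t s' where "exec d s t s'" "t \<le> poly (time_poly d) N" "B s'"
      using d A unfolding hoare_def by blast
    then show ?thesis
      using exec.CondFalse[OF True, of d t s' c]
      by (intro exI[of _ "expr_time e + t + 1"] exI[of _ s']) auto
  next
    case False
    then obtain t s' where "exec c s t s'" "t \<le> poly (time_poly c) N" "B s'"
      using c A unfolding hoare_def by blast
    then show ?thesis
      using exec.CondTrue[OF False, of c t s' d]
      by (intro exI[of _ "expr_time e + t + 1"] exI[of _ s']) auto
  qed
qed

lemma hoare_Cond_True:
  assumes "hoare N A c B" "\<And>s. A s \<Longrightarrow> val e s \<noteq> 0"
  shows "hoare N A (Cond e c d) B"
proof (rule hoare_Cond)
  show "hoare N (\<lambda>s. A s \<and> val e s \<noteq> 0) c B"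
    using assms(1) by (rule hoare_weaken) blast+
  show "hoare N (\<lambda>s. A s \<and> val e s = 0) d B"
    using assms(2) unfolding hoare_def by metis
qed

lemma hoare_Cond_False:
  assumes "hoare N A d B" "\<And>s. A s \<Longrightarrow> val e s = 0"
  shows "hoare N A (Cond e c d) B"
proof (rule hoare_Cond)
  show "hoare N (\<lambda>s. A s \<and> val e s \<noteq> 0) c B"
    using assms(2) unfolding hoare_def by metis
  show "hoare N (\<lambda>s. A s \<and> val e s = 0) d B"
    using assms(1) by (rule hoare_weaken) blast+
qed

text \<open>The invariant is indexed by the number of completed rounds and the loop makes exactly
  \<open>m\<close> of them. This takes the place of a termination measure and yields the time bound
  as well.\<close>

lemma hoare_While:
  assumes "m \<le> N"
    and cond: "\<And>k s. k < m \<Longrightarrow> Inv k s \<Longrightarrow> val e s \<noteq> 0" "\<And>s. Inv m s \<Longrightarrow> val e s = 0"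
    and body: "\<And>k. k < m \<Longrightarrow> hoare N (Inv k) c (Inv (Suc k))"
  shows "hoare N (Inv 0) (While e c) (Inv m)"
proof -
  let ?b = "poly (time_poly c) N + expr_time e + 1"
  \<comment> \<open>Here \<open>k\<close> counts the rounds still to come, hence the index
    \<open>m - k\<close>.\<close>
  have *: "\<exists>t s'. exec (While e c) s t s' \<and> t \<le> k * ?b + expr_time e + 1 \<and> Inv m s'"
    if "k \<le> m" "Inv (m - k) s" for k s
    using that
  proof (induction k arbitrary: s)
    case 0
    then show ?case
      using exec.WhileFalse[of e s c] cond(2)[of s]
      by (intro exI[of _ "expr_time e + 1"] exI[of _ s]) simp
  next
    case (Suc k)
    let ?j = "m - Suc k"
    have j: "?j < m" "Suc ?j = m - k"
      using Suc.prems by auto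
    obtain t s' where 1: "exec c s t s'" "t \<le> poly (time_poly c) N" "Inv (m - k) s'"
      using body[OF j(1)] Suc.prems(2) unfolding hoare_def j(2) by blast
    obtain u s'' where 2: "exec (While e c) s' u s''" "u \<le> k * ?b + expr_time e + 1" "Inv m s''"
      using Suc.IH[OF _ 1(3)] Suc.prems(1) by auto
    have "exec (While e c) s (expr_time e + t + u + 1) s''"
      using exec.WhileTrue[OF cond(1)[OF j(1) Suc.prems(2)] 1(1) 2(1)] .
    then show ?case
      using 1(2) 2(2,3) by (intro exI conjI) auto
  qed
  have "m * ?b \<le> N * ?b"
    using assms(1) by (rule mult_le_mono1)
  then show ?thesis
    unfolding hoare_def
  proof (intro allI impI)
    fix s assume "Inv 0 s"
    then obtain t s' where "exec (While e c) s t s'" "t \<le> m * ?b + expr_time e + 1" "Inv m s'"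
      using *[of m s] by auto
    with \<open>m * ?b \<le> N * ?b\<close>
    show "\<exists>t s'. exec (While e c) s t s' \<and> t \<le> poly (time_poly (While e c)) N \<and> Inv m s'"
      by (intro exI conjI) (auto simp: algebra_simps)
  qed
qed

fun writes :: "prog \<Rightarrow> nat set" where
  "writes (Assign r e) = {r}"
| "writes (Seq c d) = writes c \<union> writes d"
| "writes (Cond e c d) = writes c \<union> writes d"
| "writes (While e c) = writes c"
| "writes _ = {}"

lemma exec_unwritten: "exec c s t s' \<Longrightarrow> r \<notin> writes c \<Longrightarrow> fst s' r = fst s r"
  by (induction rule: exec.induct) auto

text \<open>Lets the counter of an outer loop survive a body whose specification does not mention
  it.\<close>

lemma hoare_frame:
  "hoare N A c B \<Longrightarrow> r \<notin> writes c \<Longrightarrow>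
     hoare N (\<lambda>s. A s \<and> fst s r = k) c (\<lambda>s. B s \<and> fst s r = k)"
  unfolding hoare_def using exec_unwritten by metis

text \<open>Register \<open>1\<close> holds the bound of every counting loop.\<close>

definition For :: "nat \<Rightarrow> prog \<Rightarrow> prog" where
  "For r c = Seq (Assign r (Lit 0))
     (While (Sub (Reg 1) (Reg r)) (Seq c (Assign r (Add (Reg r) (Lit 1)))))"

text \<open>Invariants of \<open>For\<close> must be independent of the counter, which the loop
  itself resets and increments.\<close>

definition reg_stable :: "nat \<Rightarrow> (state \<Rightarrow> bool) \<Rightarrow> bool" where
  "reg_stable r A \<longleftrightarrow> (\<forall>s v. A s \<longrightarrow> A ((fst s)(r := v), snd s))"

lemma hoare_For:
  assumes "n \<le> N" and r: "r \<noteq> 1"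
    and n: "\<And>k s. Inv k s \<Longrightarrow> fst s 1 = n"
    and stable: "\<And>k. reg_stable r (Inv k)"
    and body: "\<And>k. k < n \<Longrightarrow>
      hoare N (\<lambda>s. Inv k s \<and> fst s r = k) c (\<lambda>s. Inv (Suc k) s \<and> fst s r = k)"
  shows "hoare N (Inv 0) (For r c) (Inv n)"
proof -
  let ?J = "\<lambda>k s. Inv k s \<and> fst s r = k"
  have "hoare N (?J 0) (While (Sub (Reg 1) (Reg r)) (Seq c (Assign r (Add (Reg r) (Lit 1))))) (?J n)"
  proof (rule hoare_While[OF assms(1)])
    fix k assume "k < n"
    show "hoare N (?J k) (Seq c (Assign r (Add (Reg r) (Lit 1)))) (?J (Suc k))"
      by (rule hoare_Seq[OF body[OF \<open>k < n\<close>]])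
        (use stable[of "Suc k"] in \<open>auto simp: reg_stable_def intro!: hoare_run\<close>)
  qed (auto dest: n)
  moreover have "hoare N (Inv 0) (Assign r (Lit 0)) (?J 0)"
    using stable[of 0] by (auto simp: reg_stable_def intro!: hoare_run)
  ultimately show ?thesis
    unfolding For_def by (auto intro: hoare_Seq hoare_weaken)
qed

text \<open>Indexing by the set of visited cells hides the scanning order: the body only has to
  account for one more cell.\<close>

lemma hoare_For_For:
  fixes Inv :: "(nat \<times> nat) set \<Rightarrow> state \<Rightarrow> bool"
  assumes "n \<le> N" and r: "r \<noteq> 1" "r' \<noteq> 1" "r \<noteq> r'"
    and n: "\<And>D s. Inv D s \<Longrightarrow> fst s 1 = n"
    and stable: "\<And>D. reg_stable r (Inv D)" "\<And>D. reg_stable r' (Inv D)"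
    and body: "\<And>D i j. i < n \<Longrightarrow> j < n \<Longrightarrow>
      hoare N (\<lambda>s. Inv D s \<and> fst s r = i \<and> fst s r' = j) c
              (\<lambda>s. Inv (insert (i, j) D) s \<and> fst s r = i \<and> fst s r' = j)"
  shows "hoare N (Inv {}) (For r (For r' c)) (Inv ({..<n} \<times> {..<n}))"
proof -
  have "hoare N (Inv ({..<0} \<times> {..<n})) (For r (For r' c)) (Inv ({..<n} \<times> {..<n}))"
  proof (rule hoare_For[where Inv = "\<lambda>i. Inv ({..<i} \<times> {..<n})", OF assms(1) r(1) n stable(1)])
    fix i assume i: "i < n"
    let ?J = "\<lambda>j s. Inv ({..<i} \<times> {..<n} \<union> {i} \<times> {..<j}) s \<and> fst s r = i"
    have "hoare N (?J 0) (For r' c) (?J n)"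
    proof (rule hoare_For[OF assms(1) r(2)])
      show "reg_stable r' (?J k)" for k
        using stable(2) r(3) by (auto simp: reg_stable_def)
      fix j assume j: "j < n"
      have "insert (i, j) ({..<i} \<times> {..<n} \<union> {i} \<times> {..<j}) = {..<i} \<times> {..<n} \<union> {i} \<times> {..<Suc j}"
        by auto
      with body[OF i j, of "{..<i} \<times> {..<n} \<union> {i} \<times> {..<j}"]
      show "hoare N (\<lambda>s. ?J j s \<and> fst s r' = j) c (\<lambda>s. ?J (Suc j) s \<and> fst s r' = j)"
        by (simp add: conj_assoc)
    qed (auto dest: n)
    moreover have "{..<i} \<times> {..<n} \<union> {i} \<times> {..<n} = {..<Suc i} \<times> {..<n}"
      by auto
    ultimately show "hoare N (\<lambda>s. Inv ({..<i} \<times> {..<n}) s \<and> fst s r = i) (For r' c)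
        (\<lambda>s. Inv ({..<Suc i} \<times> {..<n}) s \<and> fst s r = i)"
      by simp
  qed
  then show ?thesis by simp
qed

section \<open>Memory layout\<close>

text \<open>Regions \<open>0\<close> to \<open>4\<close> are the input, and \<open>0\<close> to \<open>2\<close> also the output: preferences are extended
  in place. Behind the input come tables of \<open>i * n\<close> and of \<open>idx n a * (n * n)\<close>, which stand in for
  multiplication in address computations, the partners in \<open>\<mu>\<close> (shifted by one, \<open>0\<close> if unmatched),
  and the matrix of the interviews chosen so far.\<close>

datatype loc = Head nat | Acc nat nat | Pref agent nat nat | Prof agent nat nat | Mat nat nat
  | Mul nat | Mul2 agent | Partner agent | Itv nat nat

fun idx :: "nat \<Rightarrow> agent \<Rightarrow> nat" where
  "idx n (Man m) = m"
| "idx n (Woman w) = n + w"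

fun agent_lt :: "nat \<Rightarrow> agent \<Rightarrow> bool" where
  "agent_lt n (Man m) \<longleftrightarrow> m < n"
| "agent_lt n (Woman w) \<longleftrightarrow> w < n"

fun valid_loc :: "nat \<Rightarrow> loc \<Rightarrow> bool" where
  "valid_loc n (Head i) \<longleftrightarrow> i \<le> n"
| "valid_loc n (Acc i j) \<longleftrightarrow> i < n \<and> j < n"
| "valid_loc n (Pref a i j) \<longleftrightarrow> agent_lt n a \<and> i < n \<and> j < n"
| "valid_loc n (Prof a i j) \<longleftrightarrow> agent_lt n a \<and> i < n \<and> j < n"
| "valid_loc n (Mat i j) \<longleftrightarrow> i < n \<and> j < n"
| "valid_loc n (Mul i) \<longleftrightarrow> i < n"
| "valid_loc n (Mul2 a) \<longleftrightarrow> agent_lt n a"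
| "valid_loc n (Partner a) \<longleftrightarrow> agent_lt n a"
| "valid_loc n (Itv i j) \<longleftrightarrow> i < n \<and> j < n"

fun region :: "loc \<Rightarrow> nat" where
  "region (Head i) = 0"
| "region (Acc i j) = 1"
| "region (Pref a i j) = 2"
| "region (Prof a i j) = 3"
| "region (Mat i j) = 4"
| "region (Mul i) = 5"
| "region (Mul2 a) = 6"
| "region (Partner a) = 7"
| "region (Itv i j) = 8"

text \<open>The first region is \<open>n\<close> in unary with its terminator; preferences take one
  \<open>n * n\<close> matrix for each of the \<open>2 * n\<close> agents.\<close>

definition region_size :: "nat \<Rightarrow> nat \<Rightarrow> nat" where
  "region_size n k =
     [n + 1, n * n, 2 * (n * n * n), 2 * (n * n * n), n * n, n, 2 * n, 2 * n, n * n] ! k"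

definition region_start :: "nat \<Rightarrow> nat \<Rightarrow> nat" where
  "region_start n k = (\<Sum>i<k. region_size n i)"

fun offset :: "nat \<Rightarrow> loc \<Rightarrow> nat" where
  "offset n (Head i) = i"
| "offset n (Acc i j) = i * n + j"
| "offset n (Pref a i j) = idx n a * (n * n) + (i * n + j)"
| "offset n (Prof a i j) = idx n a * (n * n) + (i * n + j)"
| "offset n (Mat i j) = i * n + j"
| "offset n (Mul i) = i"
| "offset n (Mul2 a) = idx n a"
| "offset n (Partner a) = idx n a"
| "offset n (Itv i j) = i * n + j"

definition addr :: "nat \<Rightarrow> loc \<Rightarrow> nat" where
  "addr n l = region_start n (region l) + offset n l"

lemma digits_less: "i < a \<Longrightarrow> j < n \<Longrightarrow> i * n + j < a * (n::nat)"
proof -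
  assume "i < a" "j < n"
  then have "Suc i * n \<le> a * n"
    by (intro mult_le_mono1) simp
  with \<open>j < n\<close> show ?thesis by simp
qed

text \<open>Used twice for offsets with three coordinates: in base \<open>n * n\<close>, then in
  base \<open>n\<close>.\<close>

lemma digits_unique:
  assumes "i * n + j = i' * n + j'" "j < n" "j' < (n::nat)"
  shows "i = i' \<and> j = j'"
proof -
  have "i = (i * n + j) div n" "j = (i * n + j) mod n"
    using assms(2) by auto
  moreover have "i' = (i' * n + j') div n" "j' = (i' * n + j') mod n"
    using assms(3) by auto
  ultimately show ?thesis
    using assms(1) by metis
qed

lemma idx_less: "agent_lt n a \<Longrightarrow> idx n a < 2 * n"
  by (cases a) auto

lemma idx_inj: "agent_lt n a \<Longrightarrow> agent_lt n b \<Longrightarrow> idx n a = idx n b \<Longrightarrow> a = b"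
  by (cases a; cases b) auto

lemma offset_less: "valid_loc n l \<Longrightarrow> offset n l < region_size n (region l)"
proof (cases l)
  case (Pref a i j)
  assume "valid_loc n l"
  with Pref digits_less[OF idx_less digits_less, of n a i n j] show ?thesis
    by (simp add: region_size_def mult.assoc)
next
  case (Prof a i j)
  assume "valid_loc n l"
  with Prof digits_less[OF idx_less digits_less, of n a i n j] show ?thesis
    by (simp add: region_size_def mult.assoc)
qed (auto simp: region_size_def digits_less idx_less)

lemma offset_inj:
  assumes "valid_loc n l" "valid_loc n l'" "region l = region l'" "offset n l = offset n l'"
  shows "l = l'"
proof -
  have 2: "i = i' \<and> j = j'" if "i * n + j = i' * n + j'" "j < n" "j' < n" for i j i' j'
    using that by (rule digits_unique)
  have 3: "a = a' \<and> i = i' \<and> j = j'"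
    if "idx n a * (n * n) + (i * n + j) = idx n a' * (n * n) + (i' * n + j')"
      "agent_lt n a" "agent_lt n a'" "i < n" "i' < n" "j < n" "j' < n" for a a' i j i' j'
    using digits_unique[OF that(1)] digits_less[of i n j n] digits_less[of i' n j' n] that
      2 idx_inj[of n a a'] by blast
  show ?thesis
    using assms by (cases l; cases l') (auto dest: 2 3 idx_inj)
qed

text \<open>Offsets stay below the size of their region, so addresses in different regions are
  ordered as the regions are; within one region \<open>offset_inj\<close> decides.\<close>

lemma addr_inj:
  assumes "valid_loc n l" "valid_loc n l'" "addr n l = addr n l'"
  shows "l = l'"
proof -
  have *: "addr n l < addr n l'" if "valid_loc n l" "region l < region l'" for l l'
  proof -
    have "addr n l < region_start n (Suc (region l))"
      using offset_less[OF that(1)] by (simp add: addr_def region_start_def)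
    also have "\<dots> \<le> region_start n (region l')"
      unfolding region_start_def using that(2) by (intro sum_mono2) auto
    finally show ?thesis
      by (simp add: addr_def)
  qed
  have "region l = region l'"
    using *[of l l'] *[of l' l] assms by (metis less_irrefl nat_neq_iff)
  with assms offset_inj show ?thesis
    by (simp add: addr_def)
qed

section \<open>Expressions over the layout\<close>

text \<open>Subtraction is truncated, so every nonzero value is sent to zero.\<close>

definition neg :: "expr \<Rightarrow> expr" where
  "neg e = Sub (Lit 1) e"

definition conj :: "expr \<Rightarrow> expr \<Rightarrow> expr" where
  "conj e f = neg (Add (neg e) (neg f))"

lemma val_neg [simp]: "val (neg e) s = 0 \<longleftrightarrow> val e s \<noteq> 0"
  by (auto simp: neg_def)

lemma val_conj [simp]: "val (conj e f) s = 0 \<longleftrightarrow> val e s = 0 \<or> val f s = 0"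
  by (auto simp: conj_def)

text \<open>Registers \<open>0\<close> to \<open>3\<close> hold the length of the input, \<open>n\<close>, \<open>n * n\<close> and \<open>n * n * n\<close>. Agents
  are given by their \<open>idx\<close>.\<close>

definition woman :: "expr \<Rightarrow> expr" where
  "woman e = Add (Reg 1) e"

text \<open>The input length in \<open>Reg 0\<close> is the first address behind the input, where
  the table \<open>Mul\<close> begins; the table \<open>Mul2\<close> read by \<open>cube\<close>
  follows it.\<close>

definition row :: "expr \<Rightarrow> expr \<Rightarrow> expr" where
  "row i j = Add (Mem (Add (Reg 0) i)) j"

definition cube :: "expr \<Rightarrow> expr \<Rightarrow> expr \<Rightarrow> expr" where
  "cube a i j = Add (Mem (Add (Add (Reg 0) (Reg 1)) a)) (row i j)"

definition acc_start :: expr where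
  "acc_start = Add (Reg 1) (Lit 1)"

definition pref_start :: expr where
  "pref_start = Add acc_start (Reg 2)"

definition prof_start :: expr where
  "prof_start = Add pref_start (Add (Reg 3) (Reg 3))"

definition acc_at :: "expr \<Rightarrow> expr \<Rightarrow> expr" where
  "acc_at i j = Mem (Add acc_start (row i j))"

definition pref_addr :: "expr \<Rightarrow> expr \<Rightarrow> expr \<Rightarrow> expr" where
  "pref_addr a i j = Add pref_start (cube a i j)"

definition prof_addr :: "expr \<Rightarrow> expr \<Rightarrow> expr \<Rightarrow> expr" where
  "prof_addr a i j = Add prof_start (cube a i j)"

definition mat_addr :: "expr \<Rightarrow> expr \<Rightarrow> expr" where
  "mat_addr i j = Add (Add prof_start (Add (Reg 3) (Reg 3))) (row i j)"

definition partner_start :: expr where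
  "partner_start = Add (Reg 0) (Add (Reg 1) (Add (Reg 1) (Reg 1)))"

definition partner_addr :: "expr \<Rightarrow> expr" where
  "partner_addr a = Add partner_start a"

definition matched :: "expr \<Rightarrow> expr" where
  "matched a = Mem (partner_addr a)"

text \<open>An unmatched agent gets the value \<open>0\<close>. Connectives evaluate both arguments,
  so look-ups with this default do happen.\<close>

definition partner :: "expr \<Rightarrow> expr" where
  "partner a = Sub (matched a) (Lit 1)"

definition itv_addr :: "expr \<Rightarrow> expr \<Rightarrow> expr" where
  "itv_addr i j = Add (Add partner_start (Add (Reg 1) (Reg 1))) (row i j)"

definition rejects :: "expr \<Rightarrow> expr \<Rightarrow> expr" where
  "rejects a c = conj (matched a) (Mem (prof_addr a (partner a) c))"

definition rejects_initially :: "expr \<Rightarrow> expr \<Rightarrow> expr" where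
  "rejects_initially a c = conj (matched a) (Mem (pref_addr a (partner a) c))"

definition needed :: "expr \<Rightarrow> expr \<Rightarrow> expr" where
  "needed m w = conj (conj (acc_at m w) (neg (Mem (mat_addr m w))))
     (neg (Add (rejects_initially m w) (rejects_initially (woman w) m)))"

definition unresolved_at :: "expr \<Rightarrow> expr \<Rightarrow> expr" where
  "unresolved_at m w = conj (conj (Mem (itv_addr m w)) (neg (Mem (mat_addr m w))))
     (neg (Add (conj (matched m) (Mem (itv_addr m (partner m))))
               (conj (matched (woman w)) (Mem (itv_addr (partner (woman w)) w)))))"

section \<open>Memory contents\<close>

lemma region_start_simps [simp]:
  "region_start n 0 = 0"
  "region_start n (Suc 0) = n + 1"
  "region_start n 2 = n + 1 + n * n"
  "region_start n 3 = n + 1 + n * n + 2 * (n * n * n)"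
  "region_start n 4 = n + 1 + n * n + 4 * (n * n * n)"
  "region_start n 5 = n + 1 + 2 * (n * n) + 4 * (n * n * n)"
  "region_start n 6 = n + 1 + 2 * (n * n) + 4 * (n * n * n) + n"
  "region_start n 7 = n + 1 + 2 * (n * n) + 4 * (n * n * n) + 3 * n"
  "region_start n 8 = n + 1 + 2 * (n * n) + 4 * (n * n * n) + 5 * n"
  by (simp_all add: region_start_def region_size_def numeral_eq_Suc)

lemma addr_eq_iff: "valid_loc n l \<Longrightarrow> valid_loc n l' \<Longrightarrow> addr n l = addr n l' \<longleftrightarrow> l = l'"
  using addr_inj by blast

definition partner_code :: "(nat \<times> nat) set \<Rightarrow> agent \<Rightarrow> nat" where
  "partner_code S a = (if partners S a = {} then 0 else Suc (THE c. c \<in> partners S a))"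

context icr
begin

abbreviation n :: nat where
  "n \<equiv> num I"

section \<open>Numerical codes for partners in the matching\<close>

lemma partner_code_man: "S \<subseteq> \<mu> \<Longrightarrow> (m, w) \<in> S \<Longrightarrow> partner_code S (Man m) = Suc w"
  using matching_man[of m] by (auto simp: partner_code_def intro!: the_equality)

lemma partner_code_woman: "S \<subseteq> \<mu> \<Longrightarrow> (m, w) \<in> S \<Longrightarrow> partner_code S (Woman w) = Suc m"
  using matching_woman[of _ w] by (auto simp: partner_code_def intro!: the_equality)

lemma partner_code_eq_0: "partner_code S a = 0 \<longleftrightarrow> partners S a = {}"
  by (simp add: partner_code_def)

lemma partner_code_man_iff: "(m, w) \<in> \<mu> \<longleftrightarrow> partner_code \<mu> (Man m) = Suc w"
proof
  assume "partner_code \<mu> (Man m) = Suc w"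
  moreover from this obtain c where "(m, c) \<in> \<mu>"
    using partner_code_eq_0[of \<mu> "Man m"] by auto
  ultimately show "(m, w) \<in> \<mu>"
    using partner_code_man[of \<mu>] by auto
qed (simp add: partner_code_man)

lemma partner_code_woman_iff: "(m, w) \<in> \<mu> \<longleftrightarrow> partner_code \<mu> (Woman w) = Suc m"
proof
  assume "partner_code \<mu> (Woman w) = Suc m"
  moreover from this obtain c where "(c, w) \<in> \<mu>"
    using partner_code_eq_0[of \<mu> "Woman w"] by auto
  ultimately show "(m, w) \<in> \<mu>"
    using partner_code_woman[of \<mu>] by auto
qed (simp add: partner_code_woman)

lemma partners_matching_iff: "c \<in> partners \<mu> a \<longleftrightarrow> partner_code \<mu> a = Suc c"
  by (cases a) (simp_all flip: partner_code_man_iff partner_code_woman_iff)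

lemma partner_code_insert:
  assumes "insert (m, w) S \<subseteq> \<mu>"
  shows "partner_code (insert (m, w) S) = (partner_code S)(Man m := Suc w, Woman w := Suc m)"
proof
  fix a
  show "partner_code (insert (m, w) S) a = ((partner_code S)(Man m := Suc w, Woman w := Suc m)) a"
  proof (cases "a = Man m \<or> a = Woman w")
    case True
    then show ?thesis
      using partner_code_man[OF assms, of m w] partner_code_woman[OF assms, of m w] by auto
  next
    case False
    then have "partners (insert (m, w) S) a = partners S a"
      by (cases a) auto
    with False show ?thesis
      by (simp add: partner_code_def)
  qed
qed

lemma partner_code_le: "partner_code \<mu> a \<le> n"
proof (cases "partner_code \<mu> a")
  case (Suc c)
  then have "c < n"
    using partner_code_man_iff partner_code_woman_iff matching_acc acc_bound
    by (cases a) blast+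
  with Suc show ?thesis by simp
qed simp

text \<open>The first argument tells how far the multiplication tables have been filled.\<close>

fun content :: "nat \<Rightarrow> (agent \<Rightarrow> nat) \<Rightarrow> preferences \<Rightarrow> (nat \<times> nat) set \<Rightarrow> loc \<Rightarrow> nat" where
  "content k h Q T (Head i) = of_bool (i < n)"
| "content k h Q T (Acc i j) = of_bool ((i, j) \<in> acc I)"
| "content k h Q T (Pref a i j) = of_bool ((i, j) \<in> Q a)"
| "content k h Q T (Prof a i j) = of_bool ((i, j) \<in> P a)"
| "content k h Q T (Mat i j) = of_bool ((i, j) \<in> \<mu>)"
| "content k h Q T (Mul i) = (if i < k then i * n else 0)"
| "content k h Q T (Mul2 (Man i)) = (if i < k then i * (n * n) else 0)"
| "content k h Q T (Mul2 (Woman i)) = (if i < k then (n + i) * (n * n) else 0)"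
| "content k h Q T (Partner a) = h a"
| "content k h Q T (Itv i j) = of_bool ((i, j) \<in> T)"

definition mem_ok ::
  "nat \<Rightarrow> (agent \<Rightarrow> nat) \<Rightarrow> preferences \<Rightarrow> (nat \<times> nat) set \<Rightarrow> (nat \<Rightarrow> nat) \<Rightarrow> bool" where
  "mem_ok k h Q T f \<longleftrightarrow> (\<forall>l. valid_loc n l \<longrightarrow> f (addr n l) = content k h Q T l)"

lemma mem_ok_Itv:
  assumes "mem_ok k h Q T f" "i < n" "j < n"
  shows "mem_ok k h Q (insert (i, j) T) (f(addr n (Itv i j) := 1))"
  unfolding mem_ok_def
proof (intro allI impI)
  fix l assume "valid_loc n l"
  with assms show "(f(addr n (Itv i j) := 1)) (addr n l) = content k h Q (insert (i, j) T) l"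
    by (cases "(k, h, Q, insert (i, j) T, l)" rule: content.cases)
      (auto simp: mem_ok_def addr_eq_iff)
qed

lemma mem_ok_Pref:
  assumes "mem_ok k h Q T f" "agent_lt n a" "i < n" "j < n"
  shows "mem_ok k h (Q(a := insert (i, j) (Q a))) T (f(addr n (Pref a i j) := 1))"
  unfolding mem_ok_def
proof (intro allI impI)
  fix l assume "valid_loc n l"
  with assms show "(f(addr n (Pref a i j) := 1)) (addr n l) =
      content k h (Q(a := insert (i, j) (Q a))) T l"
    by (cases "(k, h, Q, T, l)" rule: content.cases) (auto simp: mem_ok_def addr_eq_iff)
qed

lemma mem_ok_Partner:
  assumes "mem_ok k h Q T f" "agent_lt n a"
  shows "mem_ok k (h(a := v)) Q T (f(addr n (Partner a) := v))"
  unfolding mem_ok_def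
proof (intro allI impI)
  fix l assume "valid_loc n l"
  with assms show "(f(addr n (Partner a) := v)) (addr n l) = content k (h(a := v)) Q T l"
    by (cases "(k, h, Q, T, l)" rule: content.cases) (auto simp: mem_ok_def addr_eq_iff)
qed

lemma mem_ok_Mul:
  assumes "mem_ok k h Q T f" "k < n"
  shows "mem_ok (Suc k) h Q T (f(addr n (Mul k) := k * n, addr n (Mul2 (Man k)) := k * (n * n),
    addr n (Mul2 (Woman k)) := (n + k) * (n * n)))"
  unfolding mem_ok_def
proof (intro allI impI)
  fix l assume "valid_loc n l"
  with assms show "(f(addr n (Mul k) := k * n, addr n (Mul2 (Man k)) := k * (n * n),
      addr n (Mul2 (Woman k)) := (n + k) * (n * n))) (addr n l) = content (Suc k) h Q T l"
    by (cases "(k, h, Q, T, l)" rule: content.cases)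
      (auto simp: mem_ok_def addr_eq_iff less_Suc_eq)
qed

section \<open>Values of the expressions once registers and tables are prepared\<close>

definition powers_ok :: "state \<Rightarrow> bool" where
  "powers_ok s \<longleftrightarrow>
     fst s 0 = region_start n 5 \<and> fst s 1 = n \<and> fst s 2 = n * n \<and> fst s 3 = n * n * n"

definition ready :: "(agent \<Rightarrow> nat) \<Rightarrow> preferences \<Rightarrow> (nat \<times> nat) set \<Rightarrow> state \<Rightarrow> bool" where
  "ready h Q T s \<longleftrightarrow> powers_ok s \<and> mem_ok n h Q T (snd s)"

lemma ready_content: "ready h Q T s \<Longrightarrow> valid_loc n l \<Longrightarrow> snd s (addr n l) = content n h Q T l"
  by (simp add: ready_def mem_ok_def)

lemma ready_regs:
  assumes "ready h Q T s"
  shows "fst s 0 = region_start n 5" "fst s (Suc 0) = n" "fst s 2 = n * n" "fst s 3 = n * n * n"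
  using assms by (auto simp: ready_def powers_ok_def)

context
  fixes h Q T s
  assumes ready: "ready h Q T s"
begin

lemma val_row: "val i s < n \<Longrightarrow> val (row i j) s = val i s * n + val j s"
  using ready_content[OF ready, of "Mul (val i s)"] ready_regs[OF ready]
  by (simp add: row_def addr_def add_ac)

lemma val_cube:
  "agent_lt n a \<Longrightarrow> val e s = idx n a \<Longrightarrow> val i s < n \<Longrightarrow>
     val (cube e i j) s = idx n a * (n * n) + (val i s * n + val j s)"
  using ready_content[OF ready, of "Mul2 a"] ready_regs[OF ready] val_row[of i j]
  by (cases a) (auto simp: cube_def addr_def add_ac)

lemma val_acc_at:
  "val i s < n \<Longrightarrow> val j s < n \<Longrightarrow> val (acc_at i j) s = of_bool ((val i s, val j s) \<in> acc I)"
  using ready_content[OF ready, of "Acc (val i s) (val j s)"] ready_regs[OF ready]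
  by (simp add: acc_at_def acc_start_def addr_def val_row add_ac)

lemma val_mat:
  "val i s < n \<Longrightarrow> val j s < n \<Longrightarrow> snd s (val (mat_addr i j) s) = of_bool ((val i s, val j s) \<in> \<mu>)"
proof -
  assume ij: "val i s < n" "val j s < n"
  have "val (mat_addr i j) s = addr n (Mat (val i s) (val j s))"
    using ready_regs[OF ready] ij
    by (simp add: mat_addr_def acc_start_def pref_start_def prof_start_def addr_def val_row)
  then show ?thesis
    using ready_content[OF ready] ij by simp
qed

lemma val_itv_addr:
  "val i s < n \<Longrightarrow> val (itv_addr i j) s = addr n (Itv (val i s) (val j s))"
  using ready_regs[OF ready] by (simp add: itv_addr_def partner_start_def addr_def val_row add_ac)

lemma val_itv:
  "val i s < n \<Longrightarrow> val j s < n \<Longrightarrow> snd s (addr n (Itv (val i s) (val j s))) = of_bool ((val i s, val j s) \<in> T)"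
  using ready_content[OF ready, of "Itv (val i s) (val j s)"] by simp

lemma val_pref_addr:
  "agent_lt n a \<Longrightarrow> val e s = idx n a \<Longrightarrow> val i s < n \<Longrightarrow>
     val (pref_addr e i j) s = addr n (Pref a (val i s) (val j s))"
  using ready_regs[OF ready] val_cube[of a e i j]
  by (simp add: pref_addr_def acc_start_def pref_start_def addr_def)

lemma val_prof:
  "agent_lt n a \<Longrightarrow> val e s = idx n a \<Longrightarrow> val i s < n \<Longrightarrow> val j s < n \<Longrightarrow>
     snd s (val (prof_addr e i j) s) = of_bool ((val i s, val j s) \<in> P a)"
proof -
  assume e: "agent_lt n a" "val e s = idx n a" and ij: "val i s < n" "val j s < n"
  have "val (prof_addr e i j) s = addr n (Prof a (val i s) (val j s))"
    using ready_regs[OF ready] e ij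
    by (simp add: prof_addr_def acc_start_def pref_start_def prof_start_def addr_def val_cube)
  then show ?thesis
    using ready_content[OF ready] e ij by simp
qed

lemma val_partner_addr:
  "val e s = idx n a \<Longrightarrow> val (partner_addr e) s = addr n (Partner a)"
  using ready_regs[OF ready] by (simp add: partner_addr_def partner_start_def addr_def)

lemma val_matched:
  "agent_lt n a \<Longrightarrow> val e s = idx n a \<Longrightarrow> val (matched e) s = h a"
  using ready_content[OF ready, of "Partner a"] val_partner_addr by (simp add: matched_def)

lemma val_woman: "val (woman e) s = n + val e s"
  using ready_regs[OF ready] by (simp add: woman_def)

end

context
  fixes Q T s
  assumes ready: "ready (partner_code \<mu>) Q T s"
begin

text \<open>The default \<open>0\<close> of an unmatched agent is in range because \<open>n\<close>
  exceeds the number of that agent.\<close>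

lemma val_partner_less: "agent_lt n a \<Longrightarrow> val e s = idx n a \<Longrightarrow> val (partner e) s < n"
  using val_matched[OF ready, of a e] partner_code_le[of a] by (cases a) (auto simp: partner_def)

lemma val_rejects:
  "agent_lt n a \<Longrightarrow> val e s = idx n a \<Longrightarrow> val c s < n \<Longrightarrow>
     val (rejects e c) s \<noteq> 0 \<longleftrightarrow> (\<exists>x \<in> partners \<mu> a. (x, val c s) \<in> P a)"
  using val_matched[OF ready, of a e] val_partner_less[of a e]
    val_prof[OF ready, of a e "partner e" c]
  by (cases "partner_code \<mu> a") (auto simp: rejects_def partner_def partners_matching_iff)

lemma val_rejects_initially:
  "agent_lt n a \<Longrightarrow> val e s = idx n a \<Longrightarrow> val c s < n \<Longrightarrow>
     val (rejects_initially e c) s \<noteq> 0 \<longleftrightarrow> (\<exists>x \<in> partners \<mu> a. (x, val c s) \<in> Q a)"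
  using val_matched[OF ready, of a e] val_partner_less[of a e]
    val_pref_addr[OF ready, of a e "partner e" c]
    ready_content[OF ready, of "Pref a (val (partner e) s) (val c s)"]
  by (cases "partner_code \<mu> a") (auto simp: rejects_initially_def partner_def partners_matching_iff)

lemma val_rejects_man:
  "val m s < n \<Longrightarrow> val w s < n \<Longrightarrow> val (rejects m w) s = 0 \<longleftrightarrow> (val m s, val w s) \<notin> man_rejects"
  using val_rejects[of "Man (val m s)" m w] by (auto simp: man_rejects_def)

lemma val_rejects_woman:
  "val m s < n \<Longrightarrow> val w s < n \<Longrightarrow>
     val (rejects (woman w) m) s = 0 \<longleftrightarrow> (val m s, val w s) \<notin> woman_rejects"
  using val_rejects[of "Woman (val w s)" "woman w" m] val_woman[OF ready]
  by (auto simp: woman_rejects_def)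

text \<open>\<open>rejects_initially\<close> reads the preference region, which holds the relations
  of \<open>I\<close> only until \<open>interview_all\<close> extends them; hence
  \<open>Q = pref I\<close>.\<close>

lemma val_needed:
  "Q = pref I \<Longrightarrow> val m s < n \<Longrightarrow> val w s < n \<Longrightarrow>
     val (needed m w) s \<noteq> 0 \<longleftrightarrow> (val m s, val w s) \<in> need"
  using val_rejects_initially[of "Woman (val w s)" "woman w" m] val_woman[OF ready]
    val_rejects_initially[of "Man (val m s)" m w] val_acc_at[OF ready, of m w] val_mat[OF ready, of m w]
  by (auto simp: needed_def need_def)

lemma val_unresolved_at:
  assumes T: "initial \<subseteq> T" "T \<subseteq> need \<union> \<mu>" and m: "val m s < n" and w: "val w s < n"
  shows "val (unresolved_at m w) s \<noteq> 0 \<longleftrightarrow> (val m s, val w s) \<in> unresolved T"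
proof -
  \<comment> \<open>Here \<open>need\<close> is read off the interview matrix: all needed pairs were
    put in by \<open>initial\<close>, and everything else chosen lies in
    \<open>\<mu>\<close>.\<close>
  have "(val m s, val w s) \<in> T - \<mu> \<longleftrightarrow> (val m s, val w s) \<in> need"
    using T need_sub need_sub_initial by blast
  moreover have "val (conj (matched m) (Mem (itv_addr m (partner m)))) s \<noteq> 0 \<longleftrightarrow>
      (\<exists>x. (val m s, x) \<in> \<mu> \<inter> T)"
    using val_matched[OF ready, of "Man (val m s)" m] val_partner_less[of "Man (val m s)" m] m
      val_itv_addr[OF ready, of m "partner m"] val_itv[OF ready, of m "partner m"]
    by (cases "partner_code \<mu> (Man (val m s))") (auto simp: partner_code_man_iff partner_def)
  moreover have "val (conj (matched (woman w)) (Mem (itv_addr (partner (woman w)) w))) s \<noteq> 0 \<longleftrightarrow>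
      (\<exists>x. (x, val w s) \<in> \<mu> \<inter> T)"
    using val_matched[OF ready, of "Woman (val w s)" "woman w"] val_woman[OF ready]
      val_partner_less[of "Woman (val w s)" "woman w"] w
      val_itv_addr[OF ready, of "partner (woman w)" w] val_itv[OF ready, of "partner (woman w)" w]
    by (cases "partner_code \<mu> (Woman (val w s))") (auto simp: partner_code_woman_iff partner_def)
  ultimately show ?thesis
    using val_itv_addr[OF ready, of m w] val_itv[OF ready, of m w] val_mat[OF ready, of m w] m w
    by (auto simp: unresolved_at_def unresolved_def)
qed

end

end

section \<open>The program\<close>

text \<open>Scans the unary \<open>n\<close> at the front of the input; the \<open>False\<close>
  behind it stops the loop.\<close>

definition count_num :: prog where
  "count_num = While (Mem (Reg 1)) (Assign 1 (Add (Reg 1) (Lit 1)))"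

definition powers :: prog where
  "powers = Seq (For 8 (Assign 2 (Add (Reg 2) (Reg 1)))) (For 8 (Assign 3 (Add (Reg 3) (Reg 2))))"

text \<open>Registers \<open>4\<close> and \<open>5\<close> run through the multiples of
  \<open>n\<close> and \<open>n * n\<close>. Woman \<open>k\<close> has index \<open>n + k\<close>,
  so her entry is that of man \<open>k\<close> plus \<open>n * n * n\<close>.\<close>

definition tables :: prog where
  "tables = For 8
     (Seq (Store (Add (Reg 0) (Reg 8)) (Reg 4))
     (Seq (Store (Add (Add (Reg 0) (Reg 1)) (Reg 8)) (Reg 5))
     (Seq (Store (Add (Add (Reg 0) (Reg 1)) (woman (Reg 8))) (Add (Reg 5) (Reg 3)))
     (Seq (Assign 4 (Add (Reg 4) (Reg 1))) (Assign 5 (Add (Reg 5) (Reg 2)))))))"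

definition find_partners :: prog where
  "find_partners = For 8 (For 9 (Cond (Mem (mat_addr (Reg 8) (Reg 9)))
     (Seq (Store (partner_addr (Reg 8)) (Add (Reg 9) (Lit 1)))
          (Store (partner_addr (woman (Reg 9))) (Add (Reg 8) (Lit 1))))
     Skip))"

definition cover_man :: "expr \<Rightarrow> prog" where
  "cover_man m = Cond (matched m) (Store (itv_addr m (partner m)) (Lit 1)) Skip"

definition cover_woman :: "expr \<Rightarrow> prog" where
  "cover_woman w = Cond (matched (woman w)) (Store (itv_addr (partner (woman w)) w) (Lit 1)) Skip"

definition initialise :: prog where
  "initialise = For 8 (For 9 (Cond (needed (Reg 8) (Reg 9))
     (Seq (Store (itv_addr (Reg 8) (Reg 9)) (Lit 1))
     (Seq (Cond (rejects (Reg 8) (Reg 9)) Skip (cover_woman (Reg 9)))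
          (Cond (rejects (woman (Reg 9)) (Reg 8)) Skip (cover_man (Reg 8)))))
     Skip))"

text \<open>Register \<open>12\<close> tells whether the man in register \<open>8\<close> is a source; register \<open>11\<close> holds the
  successor of the selected woman, or \<open>0\<close>.\<close>

definition test_source :: prog where
  "test_source = Seq (Assign 12 (Lit 1))
     (For 10 (Cond (unresolved_at (Reg 10) (partner (Reg 8))) (Assign 12 (Lit 0)) Skip))"

text \<open>The choice is overwritten if there is none yet or if the new tail is a source, so a
  non-source survives the scan only if no source is met.\<close>

definition select :: prog where
  "select = Seq (Assign 11 (Lit 0)) (For 8 (For 9 (Cond (unresolved_at (Reg 8) (Reg 9))
     (Seq test_source (Cond (Add (Reg 12) (neg (Reg 11))) (Assign 11 (Add (Reg 9) (Lit 1))) Skip))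
     Skip)))"

definition step :: prog where
  "step = Seq select (Cond (Reg 11) (cover_woman (Sub (Reg 11) (Lit 1))) Skip)"

definition order_pair_man :: prog where
  "order_pair_man = Cond
     (conj (conj (Mem (itv_addr (Reg 8) (Reg 9))) (Mem (itv_addr (Reg 8) (Reg 10))))
           (Mem (prof_addr (Reg 8) (Reg 9) (Reg 10))))
     (Store (pref_addr (Reg 8) (Reg 9) (Reg 10)) (Lit 1)) Skip"

definition order_pair_woman :: prog where
  "order_pair_woman = Cond
     (conj (conj (Mem (itv_addr (Reg 9) (Reg 8))) (Mem (itv_addr (Reg 10) (Reg 8))))
           (Mem (prof_addr (woman (Reg 8)) (Reg 9) (Reg 10))))
     (Store (pref_addr (woman (Reg 8)) (Reg 9) (Reg 10)) (Lit 1)) Skip"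

definition interview_all :: prog where
  "interview_all = For 8 (For 9 (For 10 (Seq order_pair_man order_pair_woman)))"

text \<open>Regions \<open>0\<close> to \<open>2\<close> already form the encoding of an instance,
  so setting the length to the start of region \<open>3\<close> turns the memory into the
  output.\<close>

definition solver :: prog where
  "solver = Seq count_num (Seq powers (Seq tables (Seq find_partners (Seq initialise
     (Seq (For 13 step) (Seq interview_all (Assign 0 prof_start)))))))"

lemma hoare_ex: "(\<And>x. hoare N (A x) c B) \<Longrightarrow> hoare N (\<lambda>s. \<exists>x. A x s) c B"
  unfolding hoare_def by blast

context icr
begin

section \<open>Effect of single writes on the memory contents\<close>

lemma ready_Itv:
  "ready h Q T s \<Longrightarrow> i < n \<Longrightarrow> j < n \<Longrightarrow>
     ready h Q (insert (i, j) T) (fst s, (snd s)(addr n (Itv i j) := Suc 0))"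
  using mem_ok_Itv by (simp add: ready_def powers_ok_def)

lemma ready_Pref:
  "ready h Q T s \<Longrightarrow> agent_lt n a \<Longrightarrow> i < n \<Longrightarrow> j < n \<Longrightarrow>
     ready h (Q(a := insert (i, j) (Q a))) T (fst s, (snd s)(addr n (Pref a i j) := Suc 0))"
  using mem_ok_Pref by (simp add: ready_def powers_ok_def)

lemma ready_Partner:
  "ready h Q T s \<Longrightarrow> agent_lt n a \<Longrightarrow>
     ready (h(a := v)) Q T (fst s, (snd s)(addr n (Partner a) := v))"
  using mem_ok_Partner by (simp add: ready_def powers_ok_def)

lemma ready_upd: "r \<ge> 4 \<Longrightarrow> ready h Q T ((fst s)(r := v), snd s) \<longleftrightarrow> ready h Q T s"
  by (auto simp: ready_def powers_ok_def)

lemma run_cover_man: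
  assumes "ready (partner_code \<mu>) Q T s" "val m s < n"
  shows "ready (partner_code \<mu>) Q (T \<union> {(m', x) \<in> \<mu>. m' = val m s}) (run (cover_man m) s)"
    "fst (run (cover_man m) s) = fst s"
proof -
  have v: "val (matched m) s = partner_code \<mu> (Man (val m s))"
    using val_matched[OF assms(1), of "Man (val m s)" m] assms(2) by simp
  have l: "val (partner m) s < n"
    using val_partner_less[OF assms(1), of "Man (val m s)" m] assms(2) by simp
  show "ready (partner_code \<mu>) Q (T \<union> {(m', x) \<in> \<mu>. m' = val m s}) (run (cover_man m) s)"
  proof (cases "partner_code \<mu> (Man (val m s))")
    case 0
    then have eq: "{(m', x) \<in> \<mu>. m' = val m s} = {}"
      by (auto simp: partner_code_man_iff)
    with 0 v assms(1) show ?thesis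
      unfolding eq by (simp add: cover_man_def)
  next
    case (Suc y)
    then have eq: "{(m', x) \<in> \<mu>. m' = val m s} = {(val m s, y)}"
      by (auto simp: partner_code_man_iff)
    have "val (partner m) s = y"
      using Suc v by (simp add: partner_def)
    then show ?thesis
      unfolding eq using Suc v l assms(2) ready_Itv[OF assms(1), of "val m s" y] val_itv_addr[OF assms(1), of m "partner m"]
      by (simp add: cover_man_def)
  qed
qed (simp add: cover_man_def)

lemma run_cover_woman:
  assumes "ready (partner_code \<mu>) Q T s" "val w s < n"
  shows "ready (partner_code \<mu>) Q (T \<union> {(x, w') \<in> \<mu>. w' = val w s}) (run (cover_woman w) s)"
    "fst (run (cover_woman w) s) = fst s"
proof -
  have v: "val (matched (woman w)) s = partner_code \<mu> (Woman (val w s))"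
    using val_matched[OF assms(1), of "Woman (val w s)" "woman w"] val_woman[OF assms(1)] assms(2) by simp
  have l: "val (partner (woman w)) s < n"
    using val_partner_less[OF assms(1), of "Woman (val w s)" "woman w"] val_woman[OF assms(1)] assms(2)
    by simp
  show "ready (partner_code \<mu>) Q (T \<union> {(x, w') \<in> \<mu>. w' = val w s}) (run (cover_woman w) s)"
  proof (cases "partner_code \<mu> (Woman (val w s))")
    case 0
    then have eq: "{(x, w') \<in> \<mu>. w' = val w s} = {}"
      by (auto simp: partner_code_woman_iff)
    with 0 v assms(1) show ?thesis
      unfolding eq by (simp add: cover_woman_def)
  next
    case (Suc y)
    then have eq: "{(x, w') \<in> \<mu>. w' = val w s} = {(y, val w s)}"
      by (auto simp: partner_code_woman_iff)
    have "val (partner (woman w)) s = y"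
      using Suc v by (simp add: partner_def)
    then show ?thesis
      unfolding eq using Suc v l assms(2) ready_Itv[OF assms(1), of y "val w s"]
        val_itv_addr[OF assms(1), of "partner (woman w)" w]
      by (simp add: cover_woman_def)
  qed
qed (simp add: cover_woman_def)

lemma loop_free_cover [simp]: "loop_free (cover_man m)" "loop_free (cover_woman w)"
  by (simp_all add: cover_man_def cover_woman_def)

context
  fixes N
  assumes n_le: "n \<le> N"
begin

section \<open>Preparatory loops, up to the forced interviews\<close>

lemma hoare_count_num:
  "hoare N (\<lambda>s. fst s = (\<lambda>_. 0)(0 := region_start n 5) \<and> mem_ok 0 h Q T (snd s)) count_num
     (\<lambda>s. fst s = (\<lambda>_. 0)(0 := region_start n 5, 1 := n) \<and> mem_ok 0 h Q T (snd s))"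
proof -
  let ?J = "\<lambda>k s. fst s = (\<lambda>_. 0)(0 := region_start n 5, 1 := k) \<and> mem_ok 0 h Q T (snd s)"
  have mem: "snd s k = of_bool (k < n)" if "mem_ok 0 h Q T (snd s)" "k \<le> n" for s k
    using that by (auto simp: mem_ok_def addr_def dest: spec[of _ "Head k"])
  have "hoare N (?J 0) count_num (?J n)"
    unfolding count_num_def
    by (rule hoare_While[OF n_le]) (auto simp: mem intro!: hoare_run)
  then show ?thesis
    by (rule hoare_weaken) (auto simp: fun_eq_iff)
qed

lemma hoare_powers:
  "hoare N (\<lambda>s. fst s = (\<lambda>_. 0)(0 := region_start n 5, 1 := n) \<and> mem_ok 0 h Q T (snd s)) powers
     (\<lambda>s. powers_ok s \<and> fst s 4 = 0 \<and> fst s 5 = 0 \<and> mem_ok 0 h Q T (snd s))"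
proof -
  let ?B = "\<lambda>s. fst s 0 = region_start n 5 \<and> fst s 1 = n \<and> fst s 4 = 0 \<and> fst s 5 = 0 \<and>
    mem_ok 0 h Q T (snd s)"
  let ?J = "\<lambda>k s. ?B s \<and> fst s 2 = k * n \<and> fst s 3 = 0"
  let ?K = "\<lambda>k s. ?B s \<and> fst s 2 = n * n \<and> fst s 3 = k * (n * n)"
  have "hoare N (?J 0) (For 8 (Assign 2 (Add (Reg 2) (Reg 1)))) (?J n)"
    by (rule hoare_For[OF n_le]) (auto simp: reg_stable_def intro!: hoare_run)
  moreover have "hoare N (?K 0) (For 8 (Assign 3 (Add (Reg 3) (Reg 2)))) (?K n)"
    by (rule hoare_For[OF n_le]) (auto simp: reg_stable_def intro!: hoare_run)
  ultimately have "hoare N (?J 0) powers (?K n)"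
    unfolding powers_def by (rule hoare_Seq[OF _ hoare_weaken]) auto
  then show ?thesis
    by (rule hoare_weaken) (auto simp: powers_ok_def mult.assoc)
qed

lemma hoare_tables:
  "hoare N (\<lambda>s. powers_ok s \<and> fst s 4 = 0 \<and> fst s 5 = 0 \<and> mem_ok 0 h Q T (snd s)) tables
     (ready h Q T)"
proof -
  let ?J = "\<lambda>k s. powers_ok s \<and> fst s 4 = k * n \<and> fst s 5 = k * (n * n) \<and> mem_ok k h Q T (snd s)"
  have "hoare N (?J 0) tables (?J n)"
    unfolding tables_def
  proof (rule hoare_For[OF n_le])
    fix k assume k: "k < n"
    let ?c = "Seq (Store (Add (Reg 0) (Reg 8)) (Reg 4))
      (Seq (Store (Add (Add (Reg 0) (Reg 1)) (Reg 8)) (Reg 5))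
      (Seq (Store (Add (Add (Reg 0) (Reg 1)) (woman (Reg 8))) (Add (Reg 5) (Reg 3)))
      (Seq (Assign 4 (Add (Reg 4) (Reg 1))) (Assign 5 (Add (Reg 5) (Reg 2))))))"
    show "hoare N (\<lambda>s. ?J k s \<and> fst s 8 = k) ?c (\<lambda>s. ?J (Suc k) s \<and> fst s 8 = k)"
    proof (rule hoare_run)
      fix s assume s: "?J k s \<and> fst s 8 = k"
      have "addr n (Mul k) = region_start n 5 + k" "addr n (Mul2 (Man k)) = region_start n 5 + n + k"
        "addr n (Mul2 (Woman k)) = region_start n 5 + n + (n + k)"
        "(n + k) * (n * n) = k * (n * n) + n * n * n"
        by (auto simp: addr_def algebra_simps)
      with s mem_ok_Mul[OF _ k, of h Q T "snd s"]
      show "?J (Suc k) (run ?c s) \<and> fst (run ?c s) 8 = k"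
        by (simp add: powers_ok_def woman_def del: region_start_simps)
    qed simp
  qed (auto simp: reg_stable_def powers_ok_def)
  then show ?thesis
    by (rule hoare_weaken) (auto simp: ready_def)
qed

lemma hoare_find_partners:
  "hoare N (ready (\<lambda>_. 0) Q T) find_partners (ready (partner_code \<mu>) Q T)"
proof -
  let ?J = "\<lambda>D. ready (partner_code (\<mu> \<inter> D)) Q T"
  have "hoare N (?J {}) find_partners (?J ({..<n} \<times> {..<n}))"
    unfolding find_partners_def
  proof (rule hoare_For_For[OF n_le])
    fix D i j assume ij: "i < n" "j < n"
    let ?c = "Seq (Store (partner_addr (Reg 8)) (Add (Reg 9) (Lit 1)))
      (Store (partner_addr (woman (Reg 9))) (Add (Reg 8) (Lit 1)))"
    show "hoare N (\<lambda>s. ?J D s \<and> fst s 8 = i \<and> fst s 9 = j)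
      (Cond (Mem (mat_addr (Reg 8) (Reg 9)))
        ?c Skip)
      (\<lambda>s. ?J (insert (i, j) D) s \<and> fst s 8 = i \<and> fst s 9 = j)"
    proof (rule hoare_Cond; rule hoare_run)
      fix s assume s: "(?J D s \<and> fst s 8 = i \<and> fst s 9 = j) \<and> val (Mem (mat_addr (Reg 8) (Reg 9))) s \<noteq> 0"
      then have r: "?J D s" and "(i, j) \<in> \<mu>"
        using val_mat[of _ Q T s "Reg 8" "Reg 9"] ij by auto
      then have eq: "partner_code (\<mu> \<inter> insert (i, j) D) =
          (partner_code (\<mu> \<inter> D))(Man i := Suc j, Woman j := Suc i)"
        using partner_code_insert[of i j "\<mu> \<inter> D"] by simp
      let ?s = "(fst s, (snd s)(addr n (Partner (Man i)) := Suc j))"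
      have 1: "val (partner_addr (Reg 8)) s = addr n (Partner (Man i))"
        using val_partner_addr[OF r, of "Reg 8" "Man i"] s by simp
      have r1: "ready ((partner_code (\<mu> \<inter> D))(Man i := Suc j)) Q T ?s"
        using ready_Partner[OF r] ij by simp
      have "val (partner_addr (woman (Reg 9))) ?s = addr n (Partner (Woman j))"
        using val_partner_addr[OF r1, of "woman (Reg 9)" "Woman j"] val_woman[OF r1] s by simp
      moreover have "ready ((partner_code (\<mu> \<inter> D))(Man i := Suc j, Woman j := Suc i)) Q T
          (fst ?s, (snd ?s)(addr n (Partner (Woman j)) := Suc i))"
        using ready_Partner[OF r1] ij by simp
      ultimately show "?J (insert (i, j) D)
          (run ?c s) \<and>
          fst (run ?c s) 8 = i \<and>
          fst (run ?c s) 9 = j"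
        using s 1 by (simp add: eq)
    next
      fix s assume s: "(?J D s \<and> fst s 8 = i \<and> fst s 9 = j) \<and> val (Mem (mat_addr (Reg 8) (Reg 9))) s = 0"
      then have "(i, j) \<notin> \<mu>"
        using val_mat[of _ Q T s "Reg 8" "Reg 9"] ij by auto
      with s show "?J (insert (i, j) D) (run Skip s) \<and> fst (run Skip s) 8 = i \<and> fst (run Skip s) 9 = j"
        by simp
    qed simp_all
  qed (auto simp: reg_stable_def ready_upd dest: ready_regs)
  moreover have "\<mu> \<inter> {..<n} \<times> {..<n} = \<mu>"
    using matching_acc acc_bound by auto
  moreover have "partner_code {} = (\<lambda>_. 0)"
    by (simp add: fun_eq_iff partner_code_eq_0) (metis partners.elims empty_Collect_eq empty_iff)
  ultimately show ?thesis
    by simp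
qed

lemma hoare_initialise:
  "hoare N (ready (partner_code \<mu>) (pref I) {}) initialise
     (ready (partner_code \<mu>) (pref I) initial)"
proof -
  let ?J = "\<lambda>D. ready (partner_code \<mu>) (pref I) (\<Union> (forced ` D))"
  have "hoare N (?J {}) initialise (?J ({..<n} \<times> {..<n}))"
    unfolding initialise_def
  proof (rule hoare_For_For[OF n_le])
    fix D i j assume ij: "i < n" "j < n"
    let ?c = "Cond (rejects (Reg 8) (Reg 9)) Skip (cover_woman (Reg 9))"
    let ?d = "Cond (rejects (woman (Reg 9)) (Reg 8)) Skip (cover_man (Reg 8))"
    show "hoare N (\<lambda>s. ?J D s \<and> fst s 8 = i \<and> fst s 9 = j)
      (Cond (needed (Reg 8) (Reg 9)) (Seq (Store (itv_addr (Reg 8) (Reg 9)) (Lit 1)) (Seq ?c ?d)) Skip)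
      (\<lambda>s. ?J (insert (i, j) D) s \<and> fst s 8 = i \<and> fst s 9 = j)"
    proof (rule hoare_Cond)
      let ?R = "\<lambda>T s. ready (partner_code \<mu>) (pref I) T s \<and> fst s 8 = i \<and> fst s 9 = j"
      let ?T = "insert (i, j) (\<Union> (forced ` D))"
      let ?W = "{(x, w') \<in> \<mu>. w' = j \<and> (i, j) \<notin> man_rejects}"
      let ?M = "{(m', x) \<in> \<mu>. m' = i \<and> (i, j) \<notin> woman_rejects}"
      show "hoare N (\<lambda>s. (?J D s \<and> fst s 8 = i \<and> fst s 9 = j) \<and> val (needed (Reg 8) (Reg 9)) s \<noteq> 0)
        (Seq (Store (itv_addr (Reg 8) (Reg 9)) (Lit 1)) (Seq ?c ?d))
        (\<lambda>s. ?J (insert (i, j) D) s \<and> fst s 8 = i \<and> fst s 9 = j)"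
      proof (cases "(i, j) \<in> need")
        case True
        have "hoare N (?R (\<Union> (forced ` D))) (Store (itv_addr (Reg 8) (Reg 9)) (Lit 1)) (?R ?T)"
        proof (rule hoare_run)
          fix s assume s: "?R (\<Union> (forced ` D)) s"
          then show "?R ?T (run (Store (itv_addr (Reg 8) (Reg 9)) (Lit 1)) s)"
            using val_itv_addr[of _ "pref I" _ s "Reg 8" "Reg 9"] ready_Itv[of _ "pref I" _ s i j] ij
            by auto
        qed simp
        moreover have "hoare N (?R ?T) ?c (?R (?T \<union> ?W))"
        proof (rule hoare_run)
          fix s assume s: "?R ?T s"
          then show "?R (?T \<union> ?W) (run ?c s)"
            using run_cover_woman[of "pref I" ?T s "Reg 9"] val_rejects_man[of "pref I" ?T s "Reg 8" "Reg 9"] ij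
            by auto
        qed simp
        moreover have "hoare N (?R (?T \<union> ?W)) ?d (?R (?T \<union> ?W \<union> ?M))"
        proof (rule hoare_run)
          fix s assume s: "?R (?T \<union> ?W) s"
          then show "?R (?T \<union> ?W \<union> ?M) (run ?d s)"
            using run_cover_man[of "pref I" "?T \<union> ?W" s "Reg 8"]
              val_rejects_woman[of "pref I" "?T \<union> ?W" s "Reg 8" "Reg 9"] ij
            by auto
        qed simp
        ultimately have "hoare N (?R (\<Union> (forced ` D)))
            (Seq (Store (itv_addr (Reg 8) (Reg 9)) (Lit 1)) (Seq ?c ?d)) (?R (?T \<union> ?W \<union> ?M))"
          by (intro hoare_Seq)
        moreover have "?T \<union> ?W \<union> ?M = \<Union> (forced ` insert (i, j) D)"
          using True by (auto simp: forced_def)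
        ultimately show ?thesis
          by (auto intro: hoare_weaken)
      next
        case False
        then show ?thesis
          using val_needed[of "pref I" _ _ "Reg 8" "Reg 9"] ij unfolding hoare_def by fastforce
      qed
    next
      show "hoare N (\<lambda>s. (?J D s \<and> fst s 8 = i \<and> fst s 9 = j) \<and> val (needed (Reg 8) (Reg 9)) s = 0) Skip
        (\<lambda>s. ?J (insert (i, j) D) s \<and> fst s 8 = i \<and> fst s 9 = j)"
      proof (rule hoare_run)
        fix s assume s: "(?J D s \<and> fst s 8 = i \<and> fst s 9 = j) \<and> val (needed (Reg 8) (Reg 9)) s = 0"
        then have "(i, j) \<notin> need"
          using val_needed[of "pref I" _ s "Reg 8" "Reg 9"] ij by auto
        then have "forced (i, j) = {}"
          by (simp add: forced_def)
        with s show "?J (insert (i, j) D) (run Skip s) \<and> fst (run Skip s) 8 = i \<and> fst (run Skip s) 9 = j"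
          by simp
      qed simp
    qed
  qed (auto simp: reg_stable_def ready_upd dest: ready_regs)
  then show ?thesis
    by (simp add: initial_def)
qed

section \<open>The greedy covering loop\<close>

lemma unresolved_less: "(m, w) \<in> unresolved T \<Longrightarrow> m < n \<and> w < n"
  using need_sub acc_bound[of m w] by (auto simp: unresolved_def)

lemma source_iff: "(m, y) \<in> \<mu> \<Longrightarrow> source T m \<longleftrightarrow> (\<forall>x<n. (x, y) \<notin> unresolved T)"
  using matching_man[of m y] unresolved_less[of _ y T] unfolding source_def by blast

text \<open>\<open>A\<close> is left abstract so that the invariant of the surrounding scan passes
  through; it must tolerate changes to registers \<open>10\<close> and \<open>12\<close>.\<close>

lemma hoare_test_source:
  assumes T: "initial \<subseteq> T" "T \<subseteq> need \<union> \<mu>" and ij: "(i, j) \<in> unresolved T"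
    and stable: "reg_stable 10 A" "reg_stable 12 A"
    and A: "\<And>s. A s \<Longrightarrow> ready (partner_code \<mu>) Q T s \<and> fst s 8 = i"
  shows "hoare N A test_source (\<lambda>s. A s \<and> (fst s 12 \<noteq> 0 \<longleftrightarrow> source T i))"
proof -
  obtain y where y: "(i, y) \<in> \<mu>"
    using unresolved_rejects(1)[OF T(1) ij] by (auto simp: man_rejects_def)
  then have yn: "i < n" "y < n"
    using matching_acc acc_bound by blast+
  have A1: "fst s (Suc 0) = n" if "A s" for s
    using A[OF that] ready_regs by blast
  let ?J = "\<lambda>k s. A s \<and> (fst s 12 \<noteq> 0 \<longleftrightarrow> (\<forall>x<k. (x, y) \<notin> unresolved T))"
  have "hoare N (?J 0) (For 10 (Cond (unresolved_at (Reg 10) (partner (Reg 8))) (Assign 12 (Lit 0)) Skip)) (?J n)"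
  proof (rule hoare_For[OF n_le])
    fix k assume k: "k < n"
    let ?c = "Cond (unresolved_at (Reg 10) (partner (Reg 8))) (Assign 12 (Lit 0)) Skip"
    show "hoare N (\<lambda>s. ?J k s \<and> fst s 10 = k) ?c (\<lambda>s. ?J (Suc k) s \<and> fst s 10 = k)"
    proof (rule hoare_run)
      fix s assume s: "?J k s \<and> fst s 10 = k"
      then have r: "ready (partner_code \<mu>) Q T s" and i: "fst s 8 = i"
        using A by auto
      have p: "val (partner (Reg 8)) s = y"
        using val_matched[OF r, of "Man i" "Reg 8"] yn i y by (simp add: partner_def partner_code_man_iff)
      have "A (run ?c s)"
        using s stable(2) by (simp add: reg_stable_def)
      moreover have "val (unresolved_at (Reg 10) (partner (Reg 8))) s \<noteq> 0 \<longleftrightarrow> (k, y) \<in> unresolved T"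
        using val_unresolved_at[OF r T, of "Reg 10" "partner (Reg 8)"] s p k yn by simp
      ultimately show "?J (Suc k) (run ?c s) \<and> fst (run ?c s) 10 = k"
        using s by (auto simp: less_Suc_eq)
    qed simp
  qed (use stable A1 in \<open>auto simp: reg_stable_def\<close>)
  moreover have "hoare N A (Assign 12 (Lit 1)) (?J 0)"
    using stable(2) by (auto simp: reg_stable_def intro!: hoare_run)
  ultimately show ?thesis
    unfolding test_source_def source_iff[OF y] by (rule hoare_Seq[rotated])
qed

text \<open>The last clause speaks of the visited cells \<open>D\<close> only: choosing a non-source
  stays provisional until the scan is complete.\<close>

definition selected :: "(nat \<times> nat) set \<Rightarrow> (nat \<times> nat) set \<Rightarrow> nat \<Rightarrow> bool" where
  "selected T D v \<longleftrightarrow> v = 0 \<and> D \<inter> unresolved T = {} \<or>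
     (\<exists>m w. v = Suc w \<and> (m, w) \<in> unresolved T \<and>
        (source T m \<or> (\<forall>(m', w') \<in> D \<inter> unresolved T. \<not> source T m')))"

lemma hoare_select:
  assumes T: "initial \<subseteq> T" "T \<subseteq> need \<union> \<mu>"
  shows "hoare N (ready (partner_code \<mu>) Q T) select
    (\<lambda>s. ready (partner_code \<mu>) Q T s \<and> selected T ({..<n} \<times> {..<n}) (fst s 11))"
proof -
  let ?J = "\<lambda>D s. ready (partner_code \<mu>) Q T s \<and> selected T D (fst s 11)"
  let ?d = "Cond (Add (Reg 12) (neg (Reg 11))) (Assign 11 (Add (Reg 9) (Lit 1))) Skip"
  have "hoare N (?J {}) (For 8 (For 9 (Cond (unresolved_at (Reg 8) (Reg 9)) (Seq test_source ?d) Skip)))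
    (?J ({..<n} \<times> {..<n}))"
  proof (rule hoare_For_For[OF n_le])
    fix D i j assume ij: "i < n" "j < n"
    let ?A = "\<lambda>D s. ?J D s \<and> fst s 8 = i \<and> fst s 9 = j"
    have unr: "val (unresolved_at (Reg 8) (Reg 9)) s \<noteq> 0 \<longleftrightarrow> (i, j) \<in> unresolved T" if "?A D s" for s
      using that val_unresolved_at[of Q T s "Reg 8" "Reg 9", OF _ T] ij by simp
    show "hoare N (?A D) (Cond (unresolved_at (Reg 8) (Reg 9)) (Seq test_source ?d) Skip) (?A (insert (i, j) D))"
    proof (cases "(i, j) \<in> unresolved T")
      case True
      have "hoare N (?A D) test_source (\<lambda>s. ?A D s \<and> (fst s 12 \<noteq> 0 \<longleftrightarrow> source T i))"
        by (rule hoare_test_source[OF T True]) (auto simp: reg_stable_def ready_upd)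
      moreover have "hoare N (\<lambda>s. ?A D s \<and> (fst s 12 \<noteq> 0 \<longleftrightarrow> source T i)) ?d (?A (insert (i, j) D))"
        using True by (intro hoare_run) (auto simp: ready_upd selected_def)
      ultimately have "hoare N (?A D) (Seq test_source ?d) (?A (insert (i, j) D))"
        by (rule hoare_Seq)
      then show ?thesis
        using True unr by (intro hoare_Cond_True) blast+
    next
      case False
      have "hoare N (?A D) Skip (?A (insert (i, j) D))"
        using False by (intro hoare_run) (auto simp: selected_def)
      then show ?thesis
        using False unr by (intro hoare_Cond_False) blast+
    qed
  qed (auto simp: reg_stable_def ready_upd dest: ready_regs)
  moreover have "hoare N (ready (partner_code \<mu>) Q T) (Assign 11 (Lit 0)) (?J {})"
    by (intro hoare_run) (auto simp: ready_upd selected_def)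
  ultimately show ?thesis
    unfolding select_def by (rule hoare_Seq[rotated])
qed

text \<open>Each step adds a further edge of \<open>\<mu>\<close>, so \<open>n\<close> steps suffice.\<close>

definition progress :: "nat \<Rightarrow> (nat \<times> nat) set \<Rightarrow> bool" where
  "progress k T \<longleftrightarrow> partial_solution T \<and> (unresolved T = {} \<or> k \<le> card (T \<inter> \<mu>))"

lemma finite_matching: "finite \<mu>"
  using matching_acc finite_acc by (rule finite_subset)

lemma progress_step:
  assumes T: "progress k T" and mw: "(m, w) \<in> unresolved T"
    and src: "source T m \<or> (\<forall>(m', w') \<in> unresolved T. \<not> source T m')"
  shows "progress (Suc k) (T \<union> {(x, w') \<in> \<mu>. w' = w})"
proof -
  have pT: "partial_solution T" "initial \<subseteq> T"
    using T by (auto simp: progress_def partial_solution_def)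
  obtain x where x: "(x, w) \<in> \<mu>"
    using unresolved_rejects(2)[OF pT(2) mw] by (auto simp: woman_rejects_def)
  have eq: "T \<union> {(x, w') \<in> \<mu>. w' = w} = insert (x, w) T"
    using x matching_woman by auto
  have "partial_solution (insert (x, w) T)"
    using src partial_solution_insert_source[OF pT(1) mw x] partial_solution_insert_cycle[OF pT(1) mw x]
    by blast
  moreover have "(x, w) \<notin> T"
    using mw x by (auto simp: unresolved_def)
  then have "card (insert (x, w) T \<inter> \<mu>) = Suc (card (T \<inter> \<mu>))"
    using x finite_matching by simp
  ultimately show ?thesis
    using T mw unfolding eq by (auto simp: progress_def)
qed

text \<open>With an arc left over, \<open>T\<close> would contain at least \<open>n\<close> edges of
  \<open>\<mu>\<close>, hence all of them since they use distinct men. But the tail of an uncovered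
  arc is an edge of \<open>\<mu>\<close> outside \<open>T\<close>.\<close>

lemma progress_final:
  assumes "progress n T"
  shows "optimal T"
proof (rule optimal_if_all_resolved)
  show pT: "partial_solution T"
    using assms by (simp add: progress_def)
  show "unresolved T = {}"
  proof (rule ccontr)
    assume ne: "unresolved T \<noteq> {}"
    have "inj_on fst \<mu>"
      using matching_man by (auto simp: inj_on_def)
    then have "card \<mu> = card (fst ` \<mu>)"
      by (simp add: card_image)
    also have "\<dots> \<le> card {..<n}"
      using matching_acc acc_bound by (intro card_mono) auto
    finally have "card \<mu> \<le> card (T \<inter> \<mu>)"
      using assms ne by (simp add: progress_def)
    then have "T \<inter> \<mu> = \<mu>"
      using finite_matching by (intro card_seteq) auto
    moreover obtain m w where mw: "(m, w) \<in> unresolved T"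
      using ne by auto
    moreover obtain x where "(m, x) \<in> \<mu>"
      using unresolved_rejects(1)[OF _ mw] pT by (auto simp: partial_solution_def man_rejects_def)
    ultimately show False
      by (auto simp: unresolved_def)
  qed
qed

lemma hoare_step:
  "hoare N (\<lambda>s. \<exists>T. ready (partner_code \<mu>) Q T s \<and> progress k T) step
     (\<lambda>s. \<exists>T. ready (partner_code \<mu>) Q T s \<and> progress (Suc k) T)"
proof (rule hoare_ex)
  fix T
  let ?R = "ready (partner_code \<mu>) Q"
  let ?c = "Cond (Reg 11) (cover_woman (Sub (Reg 11) (Lit 1))) Skip"
  show "hoare N (\<lambda>s. ?R T s \<and> progress k T) step (\<lambda>s. \<exists>T. ?R T s \<and> progress (Suc k) T)"
  proof (cases "progress k T")
    case True
    then have T: "initial \<subseteq> T" "T \<subseteq> need \<union> \<mu>"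
      by (auto simp: progress_def partial_solution_def)
    have "hoare N (\<lambda>s. ?R T s \<and> selected T ({..<n} \<times> {..<n}) (fst s 11)) ?c
        (\<lambda>s. \<exists>T. ?R T s \<and> progress (Suc k) T)"
    proof (rule hoare_run)
      fix s assume s: "?R T s \<and> selected T ({..<n} \<times> {..<n}) (fst s 11)"
      have all: "{..<n} \<times> {..<n} \<inter> unresolved T = unresolved T"
        using unresolved_less by auto
      show "\<exists>T. ?R T (run ?c s) \<and> progress (Suc k) T"
      proof (cases "fst s 11")
        case 0
        then have "progress (Suc k) T"
          using s True all by (auto simp: selected_def progress_def)
        with s 0 show ?thesis by auto
      next
        case (Suc w)
        then obtain m where m: "(m, w) \<in> unresolved T"
          "source T m \<or> (\<forall>(m', w') \<in> unresolved T. \<not> source T m')"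
          using s all by (auto simp: selected_def)
        have "?R (T \<union> {(x, w') \<in> \<mu>. w' = w}) (run ?c s)"
          using run_cover_woman(1)[of Q T s "Sub (Reg 11) (Lit 1)"] s Suc unresolved_less[OF m(1)] by simp
        with progress_step[OF True m] show ?thesis by blast
      qed
    qed simp
    then have "hoare N (?R T) step (\<lambda>s. \<exists>T. ?R T s \<and> progress (Suc k) T)"
      unfolding step_def by (rule hoare_Seq[OF hoare_select[OF T]])
    then show ?thesis
      by (rule hoare_weaken) auto
  qed (simp add: hoare_def)
qed

lemma hoare_solve:
  "hoare N (ready (partner_code \<mu>) Q initial) (For 13 step)
     (\<lambda>s. \<exists>T. ready (partner_code \<mu>) Q T s \<and> optimal T)"
proof -
  let ?J = "\<lambda>k s. \<exists>T. ready (partner_code \<mu>) Q T s \<and> progress k T"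
  have "hoare N (?J 0) (For 13 step) (?J n)"
  proof (rule hoare_For[OF n_le])
    fix k
    show "hoare N (\<lambda>s. ?J k s \<and> fst s 13 = k) step (\<lambda>s. ?J (Suc k) s \<and> fst s 13 = k)"
      by (rule hoare_frame[OF hoare_step])
        (simp add: step_def select_def test_source_def cover_woman_def For_def)
  qed (auto simp: reg_stable_def ready_upd dest: ready_regs)
  then show ?thesis
    using partial_solution_initial progress_final
    by (elim hoare_weaken) (auto simp: progress_def)
qed

section \<open>Extending the preferences by the interviews\<close>

definition interviewed :: "(nat \<times> nat) set \<Rightarrow> (agent \<times> nat \<times> nat) set \<Rightarrow> preferences" where
  "interviewed T X a = pref I a \<union>
     {(c, d) \<in> P a. c \<in> partners T a \<and> d \<in> partners T a \<and> (a, c, d) \<in> X}"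

lemma interviewed_insert:
  "interviewed T (insert (a, c, d) X) =
     (if (c, d) \<in> P a \<and> c \<in> partners T a \<and> d \<in> partners T a
      then (interviewed T X)(a := insert (c, d) (interviewed T X a)) else interviewed T X)"
  by (auto simp: interviewed_def fun_eq_iff)

lemma run_order_pair:
  assumes r: "ready (partner_code \<mu>) (interviewed T X) T s"
    and lt: "fst s 8 < n" "fst s 9 < n" "fst s 10 < n"
  shows "ready (partner_code \<mu>) (interviewed T (insert (Man (fst s 8), fst s 9, fst s 10) X)) T
      (run order_pair_man s)" (is ?man)
    and "ready (partner_code \<mu>) (interviewed T (insert (Woman (fst s 8), fst s 9, fst s 10) X)) T
      (run order_pair_woman s)" (is ?woman)
    and "fst (run order_pair_man s) = fst s"
    and "fst (run order_pair_woman s) = fst s"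
proof -
  have itv: "snd s (val (itv_addr (Reg x) (Reg y)) s) = of_bool ((fst s x, fst s y) \<in> T)"
    if "fst s x < n" "fst s y < n" for x y
    using val_itv_addr[OF r, of "Reg x" "Reg y"] val_itv[OF r, of "Reg x" "Reg y"] that by simp
  show ?man
    using itv[of 8 9] itv[of 8 10] lt r val_prof[OF r, of "Man (fst s 8)" "Reg 8" "Reg 9" "Reg 10"]
      val_pref_addr[OF r, of "Man (fst s 8)" "Reg 8" "Reg 9" "Reg 10"]
      ready_Pref[OF r, of "Man (fst s 8)" "fst s 9" "fst s 10"]
    by (simp add: order_pair_man_def interviewed_insert)
  show ?woman
    using itv[of 9 8] itv[of 10 8] lt r val_woman[OF r, of "Reg 8"]
      val_prof[OF r, of "Woman (fst s 8)" "woman (Reg 8)" "Reg 9" "Reg 10"]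
      val_pref_addr[OF r, of "Woman (fst s 8)" "woman (Reg 8)" "Reg 9" "Reg 10"]
      ready_Pref[OF r, of "Woman (fst s 8)" "fst s 9" "fst s 10"]
    by (simp add: order_pair_woman_def interviewed_insert)
qed (simp_all add: order_pair_man_def order_pair_woman_def)

text \<open>Working in place is sound because the tests read only the interview matrix and the
  profile \<open>P\<close>, never the relations being extended.\<close>

lemma hoare_interview_all:
  assumes T: "T \<subseteq> acc I"
  shows "hoare N (ready (partner_code \<mu>) (pref I) T) interview_all
    (ready (partner_code \<mu>) (pref (refined T)) T)"
proof -
  \<comment> \<open>Register \<open>8\<close> stands for a man and for a woman at once, so a visited
    cell \<open>(i, c)\<close> accounts for the comparisons of \<open>c\<close> by both agents
    numbered \<open>i\<close>.\<close>
  define X where "X D = {(a, c, d). c < n \<and> d < n \<and> (case a of Man i \<Rightarrow> (i, c) \<in> D | Woman i \<Rightarrow> (i, c) \<in> D)}"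
    for D :: "(nat \<times> nat) set"
  let ?R = "\<lambda>X. ready (partner_code \<mu>) (interviewed T X) T"
  let ?b = "Seq order_pair_man order_pair_woman"
  have "hoare N (?R (X {})) interview_all (?R (X ({..<n} \<times> {..<n})))"
    unfolding interview_all_def
  proof (rule hoare_For_For[OF n_le])
    fix D i j assume ij: "i < n" "j < n"
    define Y where "Y k = X D \<union> {Man i, Woman i} \<times> {j} \<times> {..<k}" for k
    let ?J = "\<lambda>k s. ?R (Y k) s \<and> fst s 8 = i \<and> fst s 9 = j"
    have "hoare N (?J 0) (For 10 ?b) (?J n)"
    proof (rule hoare_For[OF n_le])
      fix k assume k: "k < n"
      show "hoare N (\<lambda>s. ?J k s \<and> fst s 10 = k) ?b (\<lambda>s. ?J (Suc k) s \<and> fst s 10 = k)"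
      proof (rule hoare_run)
        fix s assume s: "?J k s \<and> fst s 10 = k"
        have eq: "Y (Suc k) = insert (Woman i, j, k) (insert (Man i, j, k) (Y k))"
          by (auto simp: Y_def)
        from s have m: "?R (insert (Man i, j, k) (Y k)) (run order_pair_man s)"
            "fst (run order_pair_man s) = fst s"
          using run_order_pair(1,3)[of T "Y k" s] ij k by auto
        with s show "?J (Suc k) (run ?b s) \<and> fst (run ?b s) 10 = k"
          using run_order_pair(2,4)[OF m(1)] ij k by (simp add: eq)
      qed (simp add: order_pair_man_def order_pair_woman_def)
    qed (auto simp: reg_stable_def ready_upd dest: ready_regs)
    moreover have "Y 0 = X D" "Y n = X (insert (i, j) D)"
      using ij by (auto simp: Y_def X_def split: agent.splits)
    ultimately show "hoare N (\<lambda>s. ?R (X D) s \<and> fst s 8 = i \<and> fst s 9 = j) (For 10 ?b)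
        (\<lambda>s. ?R (X (insert (i, j) D)) s \<and> fst s 8 = i \<and> fst s 9 = j)"
      by simp
  qed (auto simp: reg_stable_def ready_upd dest: ready_regs)
  moreover have "interviewed T (X {}) = pref I"
    by (auto simp: interviewed_def X_def fun_eq_iff split: agent.splits)
  moreover have "interviewed T (X ({..<n} \<times> {..<n})) a = pref (refined T) a" for a
  proof -
    have "c < n" "(case a of Man i \<Rightarrow> i < n | Woman i \<Rightarrow> i < n)" if "c \<in> partners T a" for c
      using that T acc_bound by (cases a; auto)+
    then show ?thesis
      by (auto simp: interviewed_def X_def pref_refined split: agent.splits)
  qed
  then have "interviewed T (X ({..<n} \<times> {..<n})) = pref (refined T)" ..
  ultimately show ?thesis
    by simp
qed

lemma hoare_solver:
  "hoare N (\<lambda>s. fst s = (\<lambda>_. 0)(0 := region_start n 5) \<and> mem_ok 0 (\<lambda>_. 0) (pref I) {} (snd s)) solver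
     (\<lambda>s. \<exists>T h. optimal T \<and> fst s 0 = region_start n 3 \<and> mem_ok n h (pref (refined T)) T (snd s))"
proof -
  let ?B = "\<lambda>s. \<exists>T h. optimal T \<and> fst s 0 = region_start n 3 \<and> mem_ok n h (pref (refined T)) T (snd s)"
  have "hoare N (\<lambda>s. \<exists>T. ready (partner_code \<mu>) (pref I) T s \<and> optimal T)
      (Seq interview_all (Assign 0 prof_start)) ?B"
  proof (rule hoare_ex)
    fix T
    show "hoare N (\<lambda>s. ready (partner_code \<mu>) (pref I) T s \<and> optimal T)
        (Seq interview_all (Assign 0 prof_start)) ?B"
    proof (cases "optimal T")
      case True
      then have "T \<subseteq> acc I"
        by (auto simp: optimal_def resolving_def)
      moreover have "hoare N (ready (partner_code \<mu>) (pref (refined T)) T) (Assign 0 prof_start) ?B"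
        using True by (intro hoare_run)
          (auto simp: prof_start_def pref_start_def acc_start_def ready_def powers_ok_def)
      ultimately have "hoare N (ready (partner_code \<mu>) (pref I) T) (Seq interview_all (Assign 0 prof_start)) ?B"
        by (rule hoare_Seq[OF hoare_interview_all])
      then show ?thesis
        by (rule hoare_weaken) auto
    qed (simp add: hoare_def)
  qed
  then show ?thesis
    unfolding solver_def
    by (intro hoare_Seq[OF hoare_count_num] hoare_Seq[OF hoare_powers] hoare_Seq[OF hoare_tables]
        hoare_Seq[OF hoare_find_partners] hoare_Seq[OF hoare_initialise] hoare_Seq[OF hoare_solve])
qed

end

end

section \<open>Encodings in memory\<close>

definition bits_at :: "(nat \<Rightarrow> nat) \<Rightarrow> nat \<Rightarrow> bool list \<Rightarrow> bool" where
  "bits_at f b xs \<longleftrightarrow> (\<forall>i<length xs. f (b + i) = of_bool (xs ! i))"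

lemma bits_at_append: "bits_at f b (xs @ ys) \<longleftrightarrow> bits_at f b xs \<and> bits_at f (b + length xs) ys"
proof
  assume *: "bits_at f b (xs @ ys)"
  have "f (b + length xs + i) = of_bool (ys ! i)" if "i < length ys" for i
    using *[unfolded bits_at_def, rule_format, of "length xs + i"] that by (simp add: add.assoc)
  moreover have "f (b + i) = of_bool (xs ! i)" if "i < length xs" for i
    using *[unfolded bits_at_def, rule_format, of i] that by (simp add: nth_append)
  ultimately show "bits_at f b xs \<and> bits_at f (b + length xs) ys"
    by (simp add: bits_at_def)
next
  assume *: "bits_at f b xs \<and> bits_at f (b + length xs) ys"
  show "bits_at f b (xs @ ys)"
    unfolding bits_at_def
  proof (intro allI impI)
    fix i assume i: "i < length (xs @ ys)"
    show "f (b + i) = of_bool ((xs @ ys) ! i)"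
    proof (cases "i < length xs")
      case False
      then have "f (b + length xs + (i - length xs)) = of_bool (ys ! (i - length xs))"
        using *[THEN conjunct2, unfolded bits_at_def, rule_format, of "i - length xs"] i by simp
      with False show ?thesis
        by (simp add: nth_append)
    qed (use * in \<open>auto simp: bits_at_def nth_append\<close>)
  qed
qed

lemma length_concat_uniform:
  "(\<And>i. i < m \<Longrightarrow> length (g i) = k) \<Longrightarrow> length (concat (map g [0..<m])) = m * k"
  by (induction m) auto

lemma bits_at_concat:
  assumes "\<And>i. i < m \<Longrightarrow> length (g i) = k"
  shows "bits_at f b (concat (map g [0..<m])) \<longleftrightarrow> (\<forall>i<m. bits_at f (b + i * k) (g i))"
  using assms
proof (induction m)
  case 0
  show ?case by (simp add: bits_at_def)
next
  case (Suc m)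
  then have "length (concat (map g [0..<m])) = m * k"
    by (intro length_concat_uniform) simp
  with Suc show ?case
    by (simp add: bits_at_append less_Suc_eq) blast
qed

lemma bits_at_replicate_True: "bits_at f b (replicate m True) \<longleftrightarrow> (\<forall>i<m. f (b + i) = 1)"
  by (simp add: bits_at_def)

lemma length_enc_rel [simp]: "length (enc_rel m r) = m * m"
  by (simp add: enc_rel_def length_concat_uniform)

lemma bits_at_enc_rel:
  "bits_at f b (enc_rel m r) \<longleftrightarrow> (\<forall>i<m. \<forall>j<m. f (b + i * m + j) = of_bool ((i, j) \<in> r))"
  unfolding enc_rel_def by (subst bits_at_concat[where k = m]) (auto simp: bits_at_def)

lemma length_enc_preferences [simp]: "length (enc_preferences m Q) = 2 * (m * m * m)"
  by (simp add: enc_preferences_def length_concat_uniform[where k = "m * m"])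

lemma bits_at_enc_preferences:
  "bits_at f b (enc_preferences m Q) \<longleftrightarrow>
     (\<forall>a i j. agent_lt m a \<longrightarrow> i < m \<longrightarrow> j < m \<longrightarrow>
        f (b + idx m a * (m * m) + i * m + j) = of_bool ((i, j) \<in> Q a))" (is "_ \<longleftrightarrow> ?R")
proof -
  have all: "(\<forall>a. agent_lt m a \<longrightarrow> A a) \<longleftrightarrow> (\<forall>i<m. A (Man i)) \<and> (\<forall>i<m. A (Woman i))" for A
    by (metis agent.exhaust agent_lt.simps)
  have "?R \<longleftrightarrow> (\<forall>a. agent_lt m a \<longrightarrow> bits_at f (b + idx m a * (m * m)) (enc_rel m (Q a)))"
    by (auto simp: bits_at_enc_rel)
  then show ?thesis
    unfolding all enc_preferences_def
    by (simp add: bits_at_append bits_at_concat[where k = "m * m"] length_concat_uniform[where k = "m * m"]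
        algebra_simps)
qed

lemma length_enc_smp: "length (enc_smp J) = region_start (num J) 3"
  by (simp add: enc_smp_def)

lemma length_enc_icr_input: "length (enc_icr_input (J, Q, M)) = region_start (num J) 5"
  by (simp add: enc_icr_input_def length_enc_smp)

lemma bits_at_enc_smp:
  "bits_at f 0 (enc_smp J) \<longleftrightarrow>
    (\<forall>i\<le>num J. f i = of_bool (i < num J)) \<and>
    bits_at f (region_start (num J) 1) (enc_rel (num J) (acc J)) \<and>
    bits_at f (region_start (num J) 2) (enc_preferences (num J) (pref J))"
proof -
  have "(\<forall>i\<le>num J. f i = of_bool (i < num J)) \<longleftrightarrow> bits_at f 0 (replicate (num J) True @ [False])"
    by (auto simp: bits_at_append bits_at_replicate_True le_less) (auto simp: bits_at_def)
  then show ?thesis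
    unfolding enc_smp_def append_assoc[symmetric] bits_at_append by (simp add: add_ac)
qed

context icr
begin

text \<open>Memory behind the input is zero, which represents unfilled tables, no recorded partners
  and no interviews.\<close>

lemma mem_ok_input:
  "mem_ok 0 (\<lambda>_. 0) (pref I) {} (snd (input_state (enc_icr_input (I, P, \<mu>))))" (is "mem_ok _ _ _ _ ?f")
  unfolding mem_ok_def
proof (intro allI impI)
  fix l assume l: "valid_loc n l"
  have len: "length (enc_icr_input (I, P, \<mu>)) = region_start n 5"
    by (rule length_enc_icr_input)
  have "bits_at ?f 0 (enc_icr_input (I, P, \<mu>))"
    by (simp add: bits_at_def input_state_def)
  then have smp: "bits_at ?f 0 (enc_smp I)"
    and P: "bits_at ?f (region_start n 3) (enc_preferences n P)"
    and \<mu>: "bits_at ?f (region_start n 4) (enc_rel n \<mu>)"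
    by (simp_all add: enc_icr_input_def bits_at_append length_enc_smp add_ac mult.assoc)
  have zero: "?f x = 0" if "region_start n 5 \<le> x" for x
    using that unfolding input_state_def len by simp
  show "?f (addr n l) = content 0 (\<lambda>_. 0) (pref I) {} l"
    using l smp P \<mu>
    by (cases "(0::nat, \<lambda>_::agent. 0::nat, pref I, {} :: (nat \<times> nat) set, l)" rule: content.cases)
      (simp_all add: addr_def bits_at_enc_smp bits_at_enc_rel bits_at_enc_preferences zero add_ac)
qed

lemma output_is_refined:
  assumes "mem_ok k h (pref (refined T)) T' (snd s)" "fst s 0 = region_start n 3"
  shows "output_is s (enc_smp (refined T))"
proof -
  have m: "snd s (addr n l) = content k h (pref (refined T)) T' l" if "valid_loc n l" for l
    using assms that by (simp add: mem_ok_def)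
  have "snd s i = of_bool (i < n)" if "i \<le> n" for i
    using m[of "Head i"] that by (simp add: addr_def)
  moreover have "bits_at (snd s) (region_start n 1) (enc_rel n (acc I))"
    using m[of "Acc _ _"] by (simp add: addr_def bits_at_enc_rel add_ac)
  moreover have "bits_at (snd s) (region_start n 2) (enc_preferences n (pref (refined T)))"
    using m[of "Pref _ _ _"] by (simp add: addr_def bits_at_enc_preferences add_ac)
  ultimately have "bits_at (snd s) 0 (enc_smp (refined T))"
    by (simp add: bits_at_enc_smp)
  then show ?thesis
    using assms(2) by (simp add: output_is_def bits_at_def length_enc_smp)
qed

text \<open>The input length is at least \<open>n\<close> and so can serve as the loop bound
  \<open>N\<close>; the structural time bound becomes a polynomial in the input length.\<close>

lemma solver_correct:
  "\<exists>J t s. min_icr_exact_solution (I, P, \<mu>) J \<and>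
     exec solver (input_state (enc_icr_input (I, P, \<mu>))) t s \<and> output_is s (enc_smp J) \<and>
     t \<le> poly (time_poly solver) (length (enc_icr_input (I, P, \<mu>)))"
proof -
  let ?x = "enc_icr_input (I, P, \<mu>)"
  have "n \<le> length ?x"
    by (simp add: length_enc_icr_input)
  note hoare_solver[OF this]
  moreover have "fst (input_state ?x) = (\<lambda>_. 0)(0 := region_start n 5)"
    by (simp add: input_state_def length_enc_icr_input)
  ultimately obtain t s T h where "exec solver (input_state ?x) t s"
    "t \<le> poly (time_poly solver) (length ?x)" "optimal T" "fst s 0 = region_start n 3"
    "mem_ok n h (pref (refined T)) T (snd s)"
    using mem_ok_input unfolding hoare_def by blast
  then show ?thesis
    using min_icr_exact_solution_refined output_is_refined by blast
qed

end

theorem theorem18: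
  shows "solvable_in_polynomial_time enc_icr_input enc_smp
           (\<lambda>(I, P, \<mu>). min_icr_exact_input (I, P, \<mu>) \<and> smti_ties_at_most_2 I)
           min_icr_exact_solution"
  unfolding solvable_in_polynomial_time_def
proof (intro exI[of _ solver] exI[of _ "time_poly solver"] allI impI)
  fix x :: icr_input
  obtain I P \<mu> where x: "x = (I, P, \<mu>)"
    by (cases x)
  assume "case x of (I, P, \<mu>) \<Rightarrow> min_icr_exact_input (I, P, \<mu>) \<and> smti_ties_at_most_2 I"
  then interpret icr I P \<mu>
    by (simp add: icr_def x)
  show "\<exists>J t s. min_icr_exact_solution x J \<and> exec solver (input_state (enc_icr_input x)) t s \<and>
      output_is s (enc_smp J) \<and> t \<le> poly (time_poly solver) (length (enc_icr_input x))"
    using solver_correct by (simp add: x)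
qed

end
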